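(* Let $N\geq 2$, $m,q>0$, $p>1$ and assume $m+q\neq p-1$. Then the equation $$\Delta_p u=u^m|\nabla u|^q\quad\text{in }\mathbb{R}^N \tag{E}$$ has a non-constant positive radial solution if and only if $$0<q<p-1\quad\text{and}\quad m<p-q-1. \tag{C}$$ If (C) holds, then there is a constant $C=C(N,m,p,q)>0$, depending only on $N,m,p,q$, such that any non-constant positive radial solution $u$ of (E) satisfies $$\lim_{|x|\to\infty}\frac{u(x)}{|x|^{\frac{p-q}{p-1-m-q}}}=C.$$ Further, if (C) holds and $1<p<N$, then for any $a>0$ there exists a unique non-constant positive radial solution $u$ of (E) such that $u(0)=a$.
   Context: $\Delta_p u=\mathrm{div}(|\nabla u|^{p-2}\nabla u)$ is the $p$-Laplace operator. A non-constant positive radial solution of (E) is a positive, radially symmetric function $u\in C^2(\mathbb{R}^N)$ that is not constant in any neighbourhood of the origin and satisfies (E) in $\mathbb{R}^N$.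
   Formalization: For p > q+2 solutions need only be C^1 on R^N and C^2 away from the origin, with (E) holding everywhere including at 0; under (C) no C^2(R^N) solution exists then, since u'(r) ~ c r^{1/(p-1-q)} near 0. For p ≤ q+2 the class is C^2(R^N). *)

theory Defs
  imports "HOL-Analysis.Analysis"
begin

definition grad :: "(real ^ 'n \<Rightarrow> real) \<Rightarrow> real ^ 'n \<Rightarrow> real ^ 'n" where
  "grad u x = (\<chi> i. frechet_derivative u (at x) (axis i 1))"

text \<open>The next two notions are intended for open sets \<open>S\<close>.\<close>

definition C1_on :: "(real ^ 'n) set \<Rightarrow> (real ^ 'n \<Rightarrow> real) \<Rightarrow> bool" where
  "C1_on S u \<longleftrightarrow> (\<forall>x\<in>S. u differentiable (at x)) \<and> continuous_on S (grad u)"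

definition C2_on :: "(real ^ 'n) set \<Rightarrow> (real ^ 'n \<Rightarrow> real) \<Rightarrow> bool" where
  "C2_on S u \<longleftrightarrow> C1_on S u \<and>
     (\<exists>H :: real ^ 'n \<Rightarrow> real ^ 'n ^ 'n.
        (\<forall>x\<in>S. (grad u has_derivative (\<lambda>h. H x *v h)) (at x)) \<and> continuous_on S H)"

text \<open>Classical divergence: the partial derivatives \<open>\<partial>\<^sub>i V\<^sub>i\<close> exist at \<open>x\<close> and their sum is \<open>d\<close>.\<close>

definition has_divergence :: "(real ^ 'n \<Rightarrow> real ^ 'n) \<Rightarrow> real \<Rightarrow> real ^ 'n \<Rightarrow> bool" where
  "has_divergence V d x \<longleftrightarrow>
     (\<exists>D :: 'n \<Rightarrow> real.
        (\<forall>i. ((\<lambda>t. V (x + t *\<^sub>R axis i 1) $ i) has_real_derivative D i) (at 0)) \<and>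
        d = (\<Sum>i\<in>UNIV. D i))"

text \<open>At critical points of \<open>u\<close> the field \<open>|\<nabla>u|\<^sup>p\<^sup>-\<^sup>2 \<nabla>u\<close> is \<open>0\<close>, its continuous extension
  for \<open>p > 1\<close>.\<close>

definition has_p_Laplacian :: "real \<Rightarrow> (real ^ 'n \<Rightarrow> real) \<Rightarrow> real \<Rightarrow> real ^ 'n \<Rightarrow> bool" where
  "has_p_Laplacian p u d x \<longleftrightarrow>
     has_divergence (\<lambda>y. (norm (grad u y) powr (p - 2)) *\<^sub>R grad u y) d x"

definition radially_symmetric :: "(real ^ 'n \<Rightarrow> real) \<Rightarrow> bool" where
  "radially_symmetric u \<longleftrightarrow> (\<forall>x y. norm x = norm y \<longrightarrow> u x = u y)"

text \<open>Regularity. A positive radial solution that is not constant near the origin satisfies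
  \<open>u'(r) \<sim> c r powr (1 / (p - 1 - q))\<close> with \<open>c > 0\<close> as \<open>r \<rightarrow> 0\<close>. Hence, when \<open>p > q + 2\<close>, no such
  function is \<open>C\<^sup>2\<close> at the origin, although \<open>|\<nabla>u|\<^sup>p\<^sup>-\<^sup>2 \<nabla>u\<close> is differentiable there. Solutions are
  therefore required to be \<open>C\<^sup>2\<close> on the whole space when \<open>p \<le> q + 2\<close>; when \<open>p > q + 2\<close> they are
  required to be \<open>C\<^sup>1\<close> on the whole space and \<open>C\<^sup>2\<close> away from the origin. The equation is imposed
  pointwise everywhere, including at the origin, in both cases.\<close>

definition solution_regularity :: "real \<Rightarrow> real \<Rightarrow> (real ^ 'n \<Rightarrow> real) \<Rightarrow> bool" where
  "solution_regularity p q u \<longleftrightarrow> C1_on UNIV u \<and> C2_on (if p \<le> q + 2 then UNIV else - {0}) u"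

definition nonconst_pos_radial_solution ::
    "real \<Rightarrow> real \<Rightarrow> real \<Rightarrow> (real ^ 'n \<Rightarrow> real) \<Rightarrow> bool" where
  "nonconst_pos_radial_solution m p q u \<longleftrightarrow>
     solution_regularity p q u \<and>
     (\<forall>x. u x > 0) \<and>
     radially_symmetric u \<and>
     (\<forall>U. open U \<and> 0 \<in> U \<longrightarrow> \<not> u constant_on U) \<and>
     (\<forall>x. has_p_Laplacian p u (u x powr m * norm (grad u x) powr q) x)"

end

theory Submission
  imports Defs
begin

text \<open>Write \<open>N\<close> for the dimension and \<open>u(x) = v(r)\<close> with \<open>r = |x|\<close>. For radial functions the equation becomes
\<open>(r^(N - 1) |v'|^(p - 2) v')' = r^(N - 1) v\<^sup>m |v'|\<^sup>q\<close>. The weighted flux \<open>r^(N - 1) |v'|^(p - 2) v'\<close> vanishes at the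
origin and does not decrease, so \<open>v' \<ge> 0\<close>, and as \<open>u\<close> is not constant near the origin, \<open>v' > 0\<close> for
all \<open>r > 0\<close> (\<open>solution_radial_ode\<close>). If \<open>q \<ge> p - 1\<close>, the right-hand side is near the origin at most a
constant times the flux, and Gronwall's inequality contradicts the positivity of the flux
(\<open>no_solution_strong_gradient\<close>).

Let \<open>q < p - 1\<close> and \<open>k = p - 1 - q\<close>. Raising the flux to the power \<open>c = k / (p - 1)\<close> removes the gradient
from the right-hand side: with \<open>b = (N - 1) c\<close>, the equation is \<open>(r\<^sup>b v'\<^sup>k)' = c r\<^sup>b v\<^sup>m\<close>, that is,
\<open>v'(r)\<^sup>k = c r^(-b) \<integral>\<^sub>0\<^sup>r s\<^sup>b v(s)\<^sup>m ds\<close>. Solutions of this integral equation are called profiles below, and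
non-constant positive radial solutions correspond to profiles with \<open>v(0) > 0\<close> (\<open>solution_imp_profile\<close>,
\<open>profile_imp_solution\<close>). The right-hand side determines \<open>v'\<close> from \<open>v\<close> by an operator that is monotone
and homogeneous of degree \<open>\<theta> = m / k\<close>; the hypothesis \<open>m + q \<noteq> p - 1\<close> says that \<open>\<theta> \<noteq> 1\<close>.

If \<open>\<theta> > 1\<close>, a profile doubles its value on successive steps whose lengths form a convergent geometric
series, so it cannot exist for all \<open>r\<close> (\<open>no_profile\<close>).

If \<open>\<theta> < 1\<close>, the inequality \<open>\<epsilon> w \<le> v\<close> between profiles with \<open>w(0) \<le> v(0)\<close> improves itself to
\<open>\<epsilon>\<^sup>\<theta> w \<le> v\<close>, and iteration gives \<open>w \<le> v\<close> (\<open>comparison\<close>). This yields uniqueness. Existence for each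
\<open>v(0) > 0\<close> follows by monotone iteration, where sublinearity provides constants as upper barriers on
bounded intervals (\<open>profile_exists\<close>). For the behaviour at infinity there is an explicit profile
\<open>w(r) = A r\<^sup>\<gamma>\<close> with \<open>\<gamma> = (k + 1) / (k - m)\<close> and \<open>w(0) = 0\<close>. Comparison gives \<open>w \<le> v\<close>. Conversely, an
eventual bound \<open>v \<le> \<mu> w\<close> implies the eventual bound \<open>v \<le> \<mu>' w\<close> for every \<open>\<mu>' > \<mu>\<^sup>\<theta>\<close>, so the infimum of the
eventual bounds is at most \<open>1\<close>, and \<open>v / w\<close> tends to \<open>1\<close> whatever \<open>v(0)\<close> is (\<open>profile_asymptotics\<close>).\<close>

section \<open>The integral equation for radial profiles\<close>

text \<open>An Emden-Fowler type equation, \<open>(r\<^sup>b v'\<^sup>k)' = c r\<^sup>b v\<^sup>m\<close> for nondecreasing \<open>v\<close>. For the radial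
\<open>p\<close>-Laplace equation in dimension \<open>N\<close> the constants are \<open>k = p - 1 - q\<close>, \<open>c = k / (p - 1)\<close> and
\<open>b = (N - 1) c\<close>.\<close>

locale emden =
  fixes c k m b :: real
  assumes c: "c > 0" and k: "k > 0" and m: "m > 0" and b: "b > 0"
begin

text \<open>For \<open>r > 0\<close> this is \<open>c r^(-b - 1) \<integral>\<^sub>0\<^sup>r s\<^sup>b v(s)\<^sup>m ds\<close> after the substitution \<open>s = r t\<close>. In this form the singular
weight is gone: the expression is continuous up to \<open>r = 0\<close>, and monotonicity and homogeneity in \<open>v\<close> are
visible under the integral sign.\<close>

definition load :: "(real \<Rightarrow> real) \<Rightarrow> real \<Rightarrow> real" where
  "load v r = c * integral {0..1} (\<lambda>t. t powr b * v (r * t) powr m)"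

text \<open>Hence \<open>v' = slope v\<close> is the equation \<open>v'(r)\<^sup>k = c r^(-b) \<integral>\<^sub>0\<^sup>r s\<^sup>b v(s)\<^sup>m ds\<close>.\<close>

definition slope :: "(real \<Rightarrow> real) \<Rightarrow> real \<Rightarrow> real" where
  "slope v r = (r * load v r) powr (1 / k)"

definition admissible :: "(real \<Rightarrow> real) \<Rightarrow> bool" where
  "admissible v \<longleftrightarrow> continuous_on {0..} v \<and> (\<forall>r\<ge>0. v r \<ge> 0)"

definition profile :: "(real \<Rightarrow> real) \<Rightarrow> bool" where
  "profile v \<longleftrightarrow> admissible v \<and> (\<forall>r>0. (v has_real_derivative slope v r) (at r))"

lemma continuous_on_integrand:
  assumes "admissible v"
  shows "continuous_on ({0..} \<times> {0..1}) (\<lambda>(r, t). t powr b * v (r * t) powr m)"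
proof -
  have v: "continuous_on {0..} v" "\<And>r. r \<ge> 0 \<Longrightarrow> v r \<ge> 0"
    using assms by (auto simp: admissible_def)
  have "continuous_on ({0..} \<times> {0..1}) (\<lambda>x :: real \<times> real. v (fst x * snd x))"
    by (rule continuous_on_compose2[OF v(1)]) (auto intro!: continuous_intros)
  then show ?thesis
    unfolding case_prod_beta
    by (intro continuous_on_mult continuous_on_powr' continuous_intros)
       (use v m b in \<open>auto\<close>)
qed

lemma integrand_integrable:
  assumes "admissible v" "r \<ge> 0"
  shows "(\<lambda>t. t powr b * v (r * t) powr m) integrable_on {0..1}"
proof (rule integrable_continuous_real)
  have "continuous_on {0..1} ((\<lambda>(r, t). t powr b * v (r * t) powr m) \<circ> (\<lambda>t. (r, t)))"
    by (rule continuous_on_compose)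
       (auto intro!: continuous_intros continuous_on_subset[OF continuous_on_integrand[OF assms(1)]]
          simp: assms)
  then show "continuous_on {0..1} (\<lambda>t. t powr b * v (r * t) powr m)"
    by (simp add: o_def)
qed

lemma continuous_on_load:
  assumes "admissible v"
  shows "continuous_on {0..} (load v)"
proof -
  have "continuous_on {0..} (\<lambda>r. integral (cbox 0 1) (\<lambda>t. t powr b * v (r * t) powr m))"
    using integral_continuous_on_param[of "{0..}" 0 1 "\<lambda>r t. t powr b * v (r * t) powr m"]
      continuous_on_integrand[OF assms] by auto
  then show ?thesis
    unfolding load_def by (intro continuous_intros) (simp add: cbox_interval)
qed

lemma load_mono:
  assumes "admissible v" "admissible w" "r \<ge> 0" "\<And>s. 0 \<le> s \<Longrightarrow> s \<le> r \<Longrightarrow> v s \<le> w s"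
  shows "load v r \<le> load w r"
  unfolding load_def
proof (rule mult_left_mono, rule integral_le)
  fix t :: real assume t: "t \<in> {0..1}"
  then have "0 \<le> r * t" "r * t \<le> r"
    using assms(3) by (auto intro: mult_left_le)
  then show "t powr b * v (r * t) powr m \<le> t powr b * w (r * t) powr m"
    using assms m by (intro mult_left_mono powr_mono2) (auto simp: admissible_def)
qed (use c assms in \<open>auto intro: integrand_integrable\<close>)

text \<open>Powers are mapped to powers, which makes an explicit profile possible.\<close>

lemma load_power:
  assumes "r \<ge> 0" "B \<ge> 0" "e \<ge> 0"
  shows "load (\<lambda>r. B * r powr e) r = c * B powr m * r powr (e * m) / (b + 1 + e * m)"
proof -
  have "((\<lambda>t. B powr m * r powr (e * m) * t powr (b + e * m)) has_integral
      B powr m * r powr (e * m) * (1 powr (b + e * m + 1) / (b + e * m + 1))) {0..1}"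
    using b m assms by (intro has_integral_mult_right has_integral_powr_from_0)
      (auto simp: add_pos_nonneg less_le_trans[of "-1" 0])
  moreover have "t powr b * (B * (r * t) powr e) powr m
      = B powr m * r powr (e * m) * t powr (b + e * m)" if "t \<in> {0..1}" for t
    using that assms by (simp add: powr_mult powr_powr powr_add)
  ultimately have "((\<lambda>t. t powr b * (B * (r * t) powr e) powr m) has_integral
      B powr m * r powr (e * m) * (1 powr (b + e * m + 1) / (b + e * m + 1))) {0..1}"
    by (subst has_integral_cong) auto
  then show ?thesis
    unfolding load_def by (simp add: integral_unique algebra_simps)
qed

lemma load_const:
  assumes "B \<ge> 0"
  shows "load (\<lambda>_. B) r = c * B powr m / (b + 1)"
proof -
  have "((\<lambda>t. t powr b * B powr m) has_integral (1 powr (b + 1) / (b + 1)) * B powr m) {0..1}"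
    using b by (intro has_integral_mult_left has_integral_powr_from_0) auto
  from integral_unique[OF this] show ?thesis
    unfolding load_def by (simp only:) simp
qed

lemma load_nonneg: "admissible v \<Longrightarrow> r \<ge> 0 \<Longrightarrow> load v r \<ge> 0"
  unfolding load_def using c
  by (intro mult_nonneg_nonneg integral_nonneg integrand_integrable) auto

lemma load_scale:
  assumes "admissible w" "r \<ge> 0" "e \<ge> 0"
  shows "load (\<lambda>r. e * w r) r = e powr m * load w r"
proof -
  have "integral {0..1} (\<lambda>t. t powr b * (e * w (r * t)) powr m)
      = integral {0..1} (\<lambda>t. e powr m * (t powr b * w (r * t) powr m))"
    using assms by (intro integral_cong) (auto simp: powr_mult admissible_def)
  then show ?thesis unfolding load_def by simp
qed

lemma continuous_on_slope:
  assumes "admissible v"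
  shows "continuous_on {0..} (slope v)"
  unfolding slope_def
  using k load_nonneg[OF assms]
  by (intro continuous_on_powr' continuous_intros continuous_on_load assms) auto

lemma slope_nonneg: "slope v r \<ge> 0"
  by (simp add: slope_def)

lemma slope_mono:
  assumes "admissible v" "admissible w" "r \<ge> 0" "\<And>s. 0 \<le> s \<Longrightarrow> s \<le> r \<Longrightarrow> v s \<le> w s"
  shows "slope v r \<le> slope w r"
  unfolding slope_def using assms k
  by (intro powr_mono2 mult_left_mono load_mono) (auto intro!: mult_nonneg_nonneg load_nonneg)

lemma slope_scale:
  assumes "admissible w" "r \<ge> 0" "e \<ge> 0"
  shows "slope (\<lambda>r. e * w r) r = e powr (m / k) * slope w r"
  using load_scale[OF assms] assms load_nonneg[OF assms(1,2)]
  by (simp add: slope_def powr_mult powr_powr mult.left_commute)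

lemma slope_const:
  assumes "r > 0" "B \<ge> 0"
  shows "slope (\<lambda>_. B) r = B powr (m / k) * (c * r / (b + 1)) powr (1 / k)"
proof -
  have "r * load (\<lambda>_. B) r = B powr m * (c * r / (b + 1))"
    using assms by (simp add: load_const)
  then show ?thesis
    using assms b c unfolding slope_def by (simp only: powr_mult powr_powr) simp
qed

lemma admissible_scale: "admissible w \<Longrightarrow> e \<ge> 0 \<Longrightarrow> admissible (\<lambda>r. e * w r)"
  by (auto simp: admissible_def intro!: continuous_intros)

lemma admissible_const: "e \<ge> 0 \<Longrightarrow> admissible (\<lambda>r. e)"
  by (auto simp: admissible_def)

lemma profileD:
  assumes "profile v"
  shows "admissible v" "continuous_on {0..} v" "r \<ge> 0 \<Longrightarrow> v r \<ge> 0"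
    "r > 0 \<Longrightarrow> (v has_real_derivative slope v r) (at r)"
  using assms by (auto simp: profile_def admissible_def)

lemma profile_mono:
  assumes "profile v" "0 \<le> r" "r \<le> s"
  shows "v r \<le> v s"
proof (rule DERIV_nonneg_imp_increasing_open[OF assms(3)])
  show "continuous_on {r..s} v"
    using profileD(2)[OF assms(1)] by (rule continuous_on_subset) (use assms in auto)
  show "\<exists>y. (v has_real_derivative y) (at x) \<and> 0 \<le> y" if "r < x" "x < s" for x
    using profileD(4)[OF assms(1), of x] slope_nonneg[of v x] assms(2) that by auto
qed

end

section \<open>Comparison and uniqueness of profiles\<close>

context emden
begin

text \<open>Since \<open>slope\<close> is monotone and homogeneous of degree \<open>m / k\<close>, the inequality \<open>e w \<le> v\<close> gives
\<open>e^(m/k) w' \<le> v'\<close>, and integration from the origin keeps it because \<open>e^(m/k) w(0) \<le> w(0) \<le> v(0)\<close>.\<close>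

lemma comparison_step:
  assumes v: "profile v" and w: "profile w" and init: "w 0 \<le> v 0"
    and e: "0 \<le> e" "e \<le> 1" and le: "\<And>r. 0 \<le> r \<Longrightarrow> r \<le> R \<Longrightarrow> e * w r \<le> v r"
    and r: "0 \<le> r" "r \<le> R"
  shows "e powr (m / k) * w r \<le> v r"
proof -
  let ?f = "\<lambda>r. v r - e powr (m / k) * w r"
  have "?f 0 \<le> ?f r"
  proof (rule DERIV_nonneg_imp_increasing_open[OF r(1)])
    show "continuous_on {0..r} ?f"
      by (intro continuous_intros continuous_on_subset[OF profileD(2)[OF v]]
          continuous_on_subset[OF profileD(2)[OF w]]) auto
    fix x assume x: "0 < x" "x < r"
    have "e powr (m / k) * slope w x = slope (\<lambda>r. e * w r) x"
      using slope_scale[OF profileD(1)[OF w]] x e by simp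
    also have "\<dots> \<le> slope v x"
      using x e r by (intro slope_mono admissible_scale profileD(1) v w le) auto
    finally show "\<exists>y. (?f has_real_derivative y) (at x) \<and> 0 \<le> y"
      using x by (intro exI[of _ "slope v x - e powr (m / k) * slope w x"])
        (auto intro!: derivative_eq_intros profileD(4) v w)
  qed
  moreover have "e powr (m / k) * w 0 \<le> v 0"
  proof -
    have "e powr (m / k) \<le> 1 powr (m / k)"
      using e m k by (intro powr_mono2) auto
    then have "e powr (m / k) * w 0 \<le> 1 * w 0"
      using profileD(3)[OF w, of 0] by (intro mult_right_mono) auto
    then show ?thesis using init by simp
  qed
  ultimately show ?thesis by simp
qed

text \<open>On a bounded interval \<open>v \<ge> v(0) > 0\<close> and \<open>w\<close> is bounded, so \<open>e w \<le> v\<close> for some \<open>e > 0\<close>. Iterating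
\<open>comparison_step\<close> replaces \<open>e\<close> by \<open>e\<^sup>\<theta>\<close>, \<open>e^(\<theta>\<^sup>2)\<close>, and so on, with \<open>\<theta> = m / k < 1\<close>; these factors tend to
\<open>1\<close>. The case \<open>w(0) = 0\<close> is included and is used for the explicit power profile.\<close>

lemma comparison:
  assumes v: "profile v" and w: "profile w" and init: "w 0 \<le> v 0" and pos: "v 0 > 0"
    and sub: "m < k" and R: "0 \<le> R"
  shows "w R \<le> v R"
proof -
  define e where "e = min 1 (v 0 / (w R + 1))"
  have wR: "w R \<ge> 0" using profileD(3)[OF w] R by simp
  have e: "0 < e" "e \<le> 1" using pos wR by (auto simp: e_def)
  have base: "e * w r \<le> v r" if "0 \<le> r" "r \<le> R" for r
  proof -
    have "e * w r \<le> (v 0 / (w R + 1)) * w R"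
      using profile_mono[OF w that] profileD(3)[OF w that(1)] pos wR
      by (intro mult_mono) (auto simp: e_def)
    also have "\<dots> \<le> v 0" using pos wR by (simp add: field_simps)
    also have "\<dots> \<le> v r" using profile_mono[OF v order_refl that(1)] .
    finally show ?thesis .
  qed
  let ?th = "m / k"
  have th: "0 < ?th" "?th < 1" using m k sub by auto
  have iter: "e powr (?th ^ n) * w r \<le> v r" if "0 \<le> r" "r \<le> R" for n r
    using that
  proof (induction n arbitrary: r)
    case 0
    then show ?case using base e by simp
  next
    case (Suc n)
    have "e powr (?th ^ n) \<le> e powr 0"
      using e th by (intro powr_mono') auto
    then have le1: "e powr (?th ^ n) \<le> 1" using e by simp
    have "(e powr (?th ^ n)) powr ?th * w r \<le> v r"
      using Suc.IH Suc.prems le1 by (intro comparison_step[OF v w init, where R = R]) auto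
    then show ?case using m k by (simp add: powr_powr mult.commute)
  qed
  have "(\<lambda>n. ?th ^ n) \<longlonglongrightarrow> 0"
    using th by (intro LIMSEQ_realpow_zero) auto
  from this have "(\<lambda>n. e powr (?th ^ n) * w R) \<longlonglongrightarrow> e powr 0 * w R"
    using e by (intro tendsto_mult tendsto_powr tendsto_const) auto
  then have "e powr 0 * w R \<le> v R"
    by (rule LIMSEQ_le_const2) (use iter R in auto)
  then show ?thesis using e by simp
qed

lemma profile_unique:
  assumes "profile v" "profile w" "v 0 = w 0" "v 0 > 0" "m < k" "r \<ge> 0"
  shows "v r = w r"
  using comparison[of v w r] comparison[of w v r] assms by auto

end

section \<open>Existence of profiles\<close>

text \<open>Only integrability is assumed, because the limit of the monotone iteration below is not known to be
continuous before it is recognised as such an integral.\<close>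

lemma continuous_on_indefinite_integral:
  fixes f :: "real \<Rightarrow> real"
  assumes "\<And>R. f integrable_on {0..R}"
  shows "continuous_on {0..} (\<lambda>r. integral {0..r} f)"
proof (rule continuous_on_eq_continuous_within[THEN iffD2], rule ballI)
  fix x :: real assume x: "x \<in> {0..}"
  have "continuous (at x within {0..x+1}) (\<lambda>r. integral {0..r} f)"
    using indefinite_integral_continuous_1[OF assms, of "x + 1"] x
    by (auto simp: continuous_on_eq_continuous_within)
  moreover have "at x within {0..x+1} = at x within {0..}"
    by (rule at_within_nhd[of x "{..<x+1}"]) auto
  ultimately show "continuous (at x within {0..}) (\<lambda>r. integral {0..r} f)" by simp
qed

context emden
begin

definition picard :: "real \<Rightarrow> (real \<Rightarrow> real) \<Rightarrow> real \<Rightarrow> real" where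
  "picard a v r = a + integral {0..r} (slope v)"

lemma slope_integrable: "admissible v \<Longrightarrow> slope v integrable_on {0..r}"
  by (intro integrable_continuous_real continuous_on_subset[OF continuous_on_slope]) auto

lemma continuous_on_picard:
  assumes "\<And>R. slope v integrable_on {0..R}"
  shows "continuous_on {0..} (picard a v)"
  unfolding picard_def[abs_def]
  by (intro continuous_intros continuous_on_indefinite_integral assms)

lemma picard_admissible:
  assumes "admissible v" "a \<ge> 0"
  shows "admissible (picard a v)"
proof -
  have "integral {0..r} (slope v) \<ge> 0" for r
    by (intro integral_nonneg slope_integrable assms slope_nonneg)
  then show ?thesis
    using continuous_on_picard[of v a] slope_integrable[OF assms(1)] assms(2)
    by (auto simp: admissible_def picard_def)
qed

lemma picard_fixed_imp_profile:
  assumes v: "admissible v" and fp: "\<And>r. r \<ge> 0 \<Longrightarrow> v r = picard a v r"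
  shows "profile v"
proof -
  have "(v has_real_derivative slope v r) (at r)" if r: "r > 0" for r
  proof -
    have "((\<lambda>x. integral {0..x} (slope v)) has_real_derivative slope v r) (at r within {0..r+1})"
      by (rule integral_has_real_derivative)
         (use r in \<open>auto intro: continuous_on_subset[OF continuous_on_slope[OF v]]\<close>)
    moreover have "at r within {0..r+1} = at r"
      by (rule at_within_interior) (use r in auto)
    ultimately have "(picard a v has_real_derivative slope v r) (at r)"
      unfolding picard_def by (auto intro!: derivative_eq_intros)
    then show ?thesis
      by (rule has_field_derivative_transform_within_open[where S = "{0<..}"])
         (use r in \<open>auto intro: fp[symmetric]\<close>)
  qed
  with v show ?thesis by (auto simp: profile_def)
qed

lemma picard_mono:
  assumes "admissible v" "admissible w" "r \<ge> 0" "\<And>s. 0 \<le> s \<Longrightarrow> s \<le> r \<Longrightarrow> v s \<le> w s"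
  shows "picard a v r \<le> picard a w r"
  unfolding picard_def
  using assms by (intro add_left_mono integral_le slope_integrable slope_mono) auto

text \<open>Applied to a constant \<open>B\<close>, the operator gives at most \<open>a + B\<^sup>\<theta> S\<close> on \<open>[0, R]\<close>, where \<open>S\<close> depends on \<open>R\<close>
only. As \<open>\<theta> < 1\<close>, this is at most \<open>B\<close> once \<open>B\<close> is large: \<open>B\<close> is chosen such that each of the two
summands is at most \<open>B / 2\<close>.\<close>

lemma picard_const_le:
  assumes a: "a > 0" and sub: "m < k" and R: "R \<ge> 0"
  obtains B where "B \<ge> a" "\<And>r. 0 \<le> r \<Longrightarrow> r \<le> R \<Longrightarrow> picard a (\<lambda>_. B) r \<le> B"
proof -
  define S where "S = (c * R / (b + 1)) powr (1 / k) * R + 1"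
  define th where "th = m / k"
  have th: "0 < th" "th < 1" using m k sub by (auto simp: th_def)
  have S: "S > 0" using R by (auto simp: S_def intro!: add_nonneg_pos)
  define B where "B = max (2 * a) ((2 * S) powr (1 / (1 - th)))"
  have B: "B > 0" "2 * a \<le> B" using a by (auto simp: B_def)
  have "2 * S = ((2 * S) powr (1 / (1 - th))) powr (1 - th)"
    using S th by (simp add: powr_powr)
  also have "\<dots> \<le> B powr (1 - th)"
    using th by (intro powr_mono2) (auto simp: B_def)
  finally have "B powr th * (2 * S) \<le> B powr th * B powr (1 - th)"
    by (rule mult_left_mono) auto
  then have BS: "B powr th * S \<le> B / 2"
    using B by (simp flip: powr_add)
  have "picard a (\<lambda>_. B) r \<le> B" if r: "0 \<le> r" "r \<le> R" for r
  proof -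
    have bound: "slope (\<lambda>_. B) s \<le> B powr th * (c * R / (b + 1)) powr (1 / k)" if s: "s \<in> {0..r}" for s
    proof (cases "s = 0")
      case False
      then have "slope (\<lambda>_. B) s = B powr th * (c * s / (b + 1)) powr (1 / k)"
        using s B by (simp add: slope_const th_def)
      also have "\<dots> \<le> B powr th * (c * R / (b + 1)) powr (1 / k)"
        using s r c k b by (intro mult_left_mono powr_mono2 divide_right_mono) auto
      finally show ?thesis .
    qed (auto simp: slope_def)
    have "integral {0..r} (slope (\<lambda>_. B))
        \<le> integral {0..r} (\<lambda>_. B powr th * (c * R / (b + 1)) powr (1 / k))"
      using bound B by (intro integral_le slope_integrable admissible_const) auto
    also have "\<dots> = B powr th * ((c * R / (b + 1)) powr (1 / k) * r)"
      using r by simp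
    also have "\<dots> \<le> B powr th * S"
      using r by (intro mult_left_mono) (auto simp: S_def intro!: mult_left_mono add_increasing2)
    finally show ?thesis using BS B unfolding picard_def by linarith
  qed
  then show ?thesis using that[of B] B a by auto
qed

text \<open>The Picard iterates that start from the constant \<open>a\<close> increase by monotonicity and stay below the constant
barriers of \<open>picard_const_le\<close>. They converge pointwise, and two applications of dominated convergence
(inside \<open>load\<close>, then in the outer integral) show that the limit is a fixed point.\<close>

lemma profile_exists:
  assumes a: "a > 0" and sub: "m < k"
  obtains v where "profile v" "v 0 = a"
proof -
  define x where "x n = (picard a ^^ n) (\<lambda>_. a)" for n
  have x_Suc: "x (Suc n) = picard a (x n)" for n by (simp add: x_def)
  have adm: "admissible (x n)" for n
    by (induction n) (use a in \<open>auto simp: x_Suc picard_admissible, auto simp: x_def admissible_const\<close>)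
  have ge: "picard a v r \<ge> a" if "admissible v" for v r
    unfolding picard_def
    using integral_nonneg[OF slope_integrable[OF that], of r] slope_nonneg by auto
  have step: "x n r \<le> x (Suc n) r" if "r \<ge> 0" for n r
    using that
  proof (induction n arbitrary: r)
    case 0
    then show ?case using ge[OF adm[of 0]] by (simp add: x_Suc) (simp add: x_def)
  next
    case (Suc n)
    show ?case unfolding x_Suc[of "Suc n"] x_Suc[of n]
      by (rule picard_mono[OF adm, of "picard a (x n)"]) (use Suc x_Suc adm[of "Suc n"] in auto)
  qed
  have bdd: "\<exists>B\<ge>a. \<forall>n r. 0 \<le> r \<and> r \<le> R \<longrightarrow> x n r \<le> B" if R: "R \<ge> 0" for R
  proof -
    obtain B where B: "B \<ge> a" "\<And>r. 0 \<le> r \<Longrightarrow> r \<le> R \<Longrightarrow> picard a (\<lambda>_. B) r \<le> B"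
      using picard_const_le[OF a sub R] by blast
    have "x n r \<le> B" if "0 \<le> r" "r \<le> R" for n r
      using that
    proof (induction n arbitrary: r)
      case 0
      then show ?case using B by (simp add: x_def)
    next
      case (Suc n)
      have "picard a (x n) r \<le> picard a (\<lambda>_. B) r"
        using Suc B a by (intro picard_mono adm admissible_const) auto
      then show ?case using B(2)[of r] Suc.prems by (simp add: x_Suc)
    qed
    then show ?thesis using B by blast
  qed
  define v where "v r = lim (\<lambda>n. x n r)" for r
  have conv: "(\<lambda>n. x n r) \<longlonglongrightarrow> v r" if r: "r \<ge> 0" for r
  proof -
    obtain B where "\<forall>n. x n r \<le> B" using bdd[OF r] r by blast
    moreover have "incseq (\<lambda>n. x n r)" using step[OF r] by (rule incseq_SucI)
    ultimately have "convergent (\<lambda>n. x n r)"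
      using incseq_convergent[of "\<lambda>n. x n r" B] unfolding convergent_def by metis
    then show ?thesis by (simp add: v_def convergent_LIMSEQ_iff)
  qed
  have x0: "x n r \<ge> 0" if "r \<ge> 0" for n r using adm[of n] that by (auto simp: admissible_def)
  have v0: "v r \<ge> 0" if "r \<ge> 0" for r
    by (rule LIMSEQ_le_const[OF conv[OF that]]) (use x0 that in auto)
  have conv_load: "(\<lambda>n. load (x n) r) \<longlonglongrightarrow> load v r" if r: "r \<ge> 0" for r
  proof -
    obtain B where B: "B \<ge> a" "\<And>n s. 0 \<le> s \<Longrightarrow> s \<le> r \<Longrightarrow> x n s \<le> B" using bdd[OF r] by blast
    show ?thesis unfolding load_def
    proof (rule tendsto_mult[OF tendsto_const],
        rule dominated_convergence(2)[where h = "\<lambda>_. B powr m"])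
      show "(\<lambda>_. B powr m) integrable_on {0..1::real}"
        by (rule integrable_const_ivl)
      fix n and t :: real assume t: "t \<in> {0..1}"
      then have rt: "0 \<le> r * t" "r * t \<le> r" using r by (auto intro: mult_left_le)
      have "t powr b * x n (r * t) powr m \<le> 1 powr b * B powr m"
        using t b m rt B(2)[of "r * t" n] x0[of "r * t" n] by (intro mult_mono powr_mono2) auto
      then show "norm (t powr b * x n (r * t) powr m) \<le> B powr m" by simp
    next
      fix t :: real assume t: "t \<in> {0..1}"
      then have "0 \<le> r * t" using r by auto
      then show "(\<lambda>n. t powr b * x n (r * t) powr m) \<longlonglongrightarrow> t powr b * v (r * t) powr m"
        using v0[of "r * t"] m x0
        by (intro tendsto_mult tendsto_const tendsto_powr2 conv) (auto intro!: always_eventually)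
    qed (rule integrand_integrable[OF adm r])
  qed
  have conv_slope: "(\<lambda>n. slope (x n) r) \<longlonglongrightarrow> slope v r" if r: "r \<ge> 0" for r
    unfolding slope_def
  proof (rule tendsto_powr2)
    show "(\<lambda>n. r * load (x n) r) \<longlonglongrightarrow> r * load v r"
      by (intro tendsto_mult tendsto_const conv_load r)
  qed (use k r load_nonneg[OF adm r] in \<open>auto intro!: always_eventually\<close>)
  have lim: "slope v integrable_on {0..R}"
    "(\<lambda>n. integral {0..R} (slope (x n))) \<longlonglongrightarrow> integral {0..R} (slope v)" if R: "R \<ge> 0" for R
  proof -
    obtain B where B: "B \<ge> a" "\<And>n s. 0 \<le> s \<Longrightarrow> s \<le> R \<Longrightarrow> x n s \<le> B" using bdd[OF R] by blast
    have bd: "norm (slope (x n) s) \<le> slope (\<lambda>_. B) s" if "s \<in> {0..R}" for n s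
      using that slope_mono[OF adm[of n] admissible_const[of B], of s] B a slope_nonneg[of "x n" s] by auto
    have int: "slope (\<lambda>_. B) integrable_on {0..R}"
      using B a by (intro slope_integrable admissible_const) auto
    show "slope v integrable_on {0..R}"
      by (rule dominated_convergence(1)[OF slope_integrable[OF adm] int bd conv_slope]) auto
    show "(\<lambda>n. integral {0..R} (slope (x n))) \<longlonglongrightarrow> integral {0..R} (slope v)"
      by (rule dominated_convergence(2)[OF slope_integrable[OF adm] int bd conv_slope]) auto
  qed
  have int: "slope v integrable_on {0..R}" for R
    using lim(1)[of R] by (cases "R \<ge> 0") auto
  have fp: "v r = picard a v r" if r: "r \<ge> 0" for r
  proof -
    have "(\<lambda>n. x (Suc n) r) \<longlonglongrightarrow> picard a v r"
      unfolding x_Suc picard_def by (intro tendsto_intros lim r)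
    moreover have "(\<lambda>n. x (Suc n) r) \<longlonglongrightarrow> v r"
      by (rule LIMSEQ_Suc[OF conv[OF r]])
    ultimately show ?thesis using LIMSEQ_unique by blast
  qed
  have "continuous_on {0..} v"
    using continuous_on_picard[OF int, of a] fp by (subst continuous_on_cong[OF refl fp]) auto
  then have "admissible v" using v0 by (auto simp: admissible_def)
  then have "profile v" using fp by (rule picard_fixed_imp_profile)
  moreover have "v 0 = a" using fp[of 0] by (simp add: picard_def)
  ultimately show ?thesis using that by blast
qed

end

section \<open>Behaviour at infinity in the sublinear case\<close>

lemma powr_filterlim_at_top:
  fixes e :: real
  assumes "e > 0"
  shows "filterlim (\<lambda>x. x powr e) at_top at_top"
  unfolding filterlim_at_top
proof
  fix Z :: real
  have "Z \<le> x powr e" if "x \<ge> (max Z 1) powr (1 / e)" for x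
  proof -
    have "max Z 1 = ((max Z 1) powr (1 / e)) powr e"
      using assms by (simp add: powr_powr)
    also have "\<dots> \<le> x powr e"
      using assms that by (intro powr_mono2) auto
    finally show ?thesis by simp
  qed
  then show "eventually (\<lambda>x. Z \<le> x powr e) at_top"
    by (rule eventually_at_top_linorderI)
qed

context emden
begin

definition rate :: real where "rate = (k + 1) / (k - m)"

text \<open>The constant \<open>A\<close> for which \<open>A r\<^sup>\<gamma>\<close>, with \<open>\<gamma>\<close> the rate above, solves the equation: comparing coefficients
in \<open>v'\<^sup>k = r * load v\<close> gives \<open>(A \<gamma>)\<^sup>k = c A\<^sup>m / (b + 1 + \<gamma> m)\<close>. The rate itself comes from comparing
exponents, \<open>(\<gamma> - 1) k = 1 + \<gamma> m\<close>.\<close>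

definition amplitude :: real where
  "amplitude = (c / (rate powr k * (b + 1 + rate * m))) powr (1 / (k - m))"

lemma rate_pos: "m < k \<Longrightarrow> rate > 1"
  using m k by (simp add: rate_def field_simps)

lemma amplitude_pos: "m < k \<Longrightarrow> amplitude > 0"
proof -
  assume "m < k"
  then have "b + 1 + rate * m > 0"
    using rate_pos b m by (intro add_pos_pos mult_pos_pos) auto
  then show "amplitude > 0"
    using rate_pos[OF \<open>m < k\<close>] c by (simp add: amplitude_def)
qed

lemma load_power_profile:
  assumes "m < k" "r \<ge> 0"
  shows "load (\<lambda>r. amplitude * r powr rate) r
    = (amplitude * rate) powr k * r powr (rate * m)"
proof -
  have pos: "b + 1 + rate * m > 0" "rate > 0" "amplitude > 0"
    using rate_pos[OF assms(1)] amplitude_pos[OF assms(1)] m b by (auto intro!: add_pos_pos)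
  have "amplitude powr (k - m) = c / (rate powr k * (b + 1 + rate * m))"
    using assms c pos by (simp add: amplitude_def powr_powr)
  then have "amplitude powr k / amplitude powr m = c / (rate powr k * (b + 1 + rate * m))"
    by (simp add: powr_diff)
  then have "c * amplitude powr m = amplitude powr k * (rate powr k * (b + 1 + rate * m))"
    using pos by (simp add: frac_eq_eq)
  then show ?thesis
    using pos assms by (simp add: load_power powr_mult)
qed

lemma power_profile:
  assumes "m < k"
  shows "profile (\<lambda>r. amplitude * r powr rate)"
proof -
  let ?w = "\<lambda>r. amplitude * r powr rate"
  have pos: "rate > 1" "amplitude > 0"
    using rate_pos[OF assms(1)] amplitude_pos[OF assms(1)] by auto
  have "continuous_on {0..} ?w"
    using pos by (intro continuous_on_mult continuous_on_powr' continuous_intros) auto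
  moreover have "(?w has_real_derivative slope ?w r) (at r)" if r: "r > 0" for r
  proof -
    have "(1 + rate * m) / k = rate - 1"
      using assms m k by (simp add: rate_def field_simps)
    then have "(r * r powr (rate * m)) powr (1 / k) = r powr (rate - 1)"
      using r by (simp add: powr_mult powr_powr powr_add[symmetric] add_divide_distrib)
    moreover have "slope ?w r = ((amplitude * rate) powr k * (r * r powr (rate * m))) powr (1 / k)"
      unfolding slope_def using r assms by (simp add: load_power_profile mult_ac)
    ultimately have "slope ?w r = amplitude * rate * r powr (rate - 1)"
      using pos k r by (simp add: powr_mult powr_powr)
    then show ?thesis
      using r by (auto intro!: derivative_eq_intros)
  qed
  ultimately show ?thesis
    using pos by (auto simp: profile_def admissible_def)
qed

text \<open>A profile is nondecreasing, so its values below \<open>r\<close> may be replaced by \<open>v(r)\<close> under the integral. This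
gives \<open>v' \<le> D r^(1/k) v\<^sup>\<theta>\<close> with \<open>\<theta> = m / k\<close>, hence \<open>(v^(1 - \<theta>))' \<le> (1 - \<theta>) D r^(1/k)\<close>. Integration
bounds \<open>v\<close> by a multiple of \<open>r\<close> to the power \<open>(1 / k + 1) / (1 - \<theta>)\<close>, which is the rate.\<close>

lemma profile_upper_bound:
  assumes v: "profile v" and pos: "v 0 > 0" and sub: "m < k"
  obtains M where "M > 0" "\<And>r. r \<ge> 1 \<Longrightarrow> v r \<le> M * r powr rate"
proof -
  define th where "th = m / k"
  have th: "0 < th" "th < 1" using m k sub by (auto simp: th_def)
  define D where "D = (c / (b + 1)) powr (1 / k)"
  have D: "D > 0" using c b by (simp add: D_def)
  have vpos: "v r > 0" if "r \<ge> 0" for r using profile_mono[OF v order_refl that] pos by simp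
  have slope_le: "slope v r \<le> D * r powr (1 / k) * v r powr th" if r: "r > 0" for r
  proof -
    have "slope v r \<le> slope (\<lambda>_. v r) r"
      using r vpos[of r] by (intro slope_mono profileD(1)[OF v] admissible_const profile_mono[OF v]) auto
    also have "\<dots> = v r powr th * (c / (b + 1) * r) powr (1 / k)"
      using r vpos[of r] by (simp add: slope_const th_def)
    also have "\<dots> = D * r powr (1 / k) * v r powr th"
      using r c b by (simp only: powr_mult D_def mult_ac)
    finally show ?thesis .
  qed
  define E where "E = (1 - th) * D / (1 / k + 1)"
  let ?f = "\<lambda>r. E * r powr (1 / k + 1) - v r powr (1 - th)"
  have mono: "?f 0 \<le> ?f r" if r: "r \<ge> 0" for r
  proof (rule DERIV_nonneg_imp_increasing_open[OF r])
    have "continuous_on {0..r} v"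
      by (rule continuous_on_subset[OF profileD(2)[OF v]]) auto
    then show "continuous_on {0..r} ?f"
      using k th vpos by (intro continuous_on_diff continuous_on_mult continuous_on_powr' continuous_intros)
         (auto simp: less_imp_le add_pos_pos)
    fix x assume x: "0 < x" "x < r"
    have "v x powr - th * slope v x \<le> v x powr - th * (D * x powr (1 / k) * v x powr th)"
      using slope_le[OF x(1)] by (rule mult_left_mono) auto
    also have "\<dots> = D * x powr (1 / k)"
      using vpos[of x] x by (simp add: powr_minus field_simps)
    finally have *: "v x powr - th * slope v x \<le> D * x powr (1 / k)" .
    have "((\<lambda>r. E * r powr (1 / k + 1)) has_real_derivative E * ((1 / k + 1) * x powr (1 / k))) (at x)"
      using has_real_derivative_powr[OF x(1), of "1 / k + 1"] by (intro DERIV_cmult) simp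
    moreover have "E * ((1 / k + 1) * x powr (1 / k)) = (1 - th) * (D * x powr (1 / k))"
    proof -
      have "1 / k + 1 > 0" using k by (simp add: add_pos_pos)
      then show ?thesis by (simp add: E_def)
    qed
    moreover have "((\<lambda>r. v r powr (1 - th)) has_real_derivative
        (1 - th) * v x powr - th * slope v x) (at x)"
      using DERIV_fun_powr[OF profileD(4)[OF v x(1)] vpos, of "1 - th"] x by simp
    ultimately have "(?f has_real_derivative
        (1 - th) * (D * x powr (1 / k) - v x powr - th * slope v x)) (at x)"
      by (simp only: right_diff_distrib mult.assoc DERIV_diff)
    then show "\<exists>y. (?f has_real_derivative y) (at x) \<and> 0 \<le> y"
      using * th by (intro exI conjI) auto
  qed
  define M0 where "M0 = E + v 0 powr (1 - th)"
  have E: "E > 0" using th D k by (auto simp: E_def add_pos_pos)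
  have M0: "M0 > 0" using E by (simp add: M0_def add_pos_nonneg)
  have "v r \<le> M0 powr (1 / (1 - th)) * r powr rate" if r: "r \<ge> 1" for r
  proof -
    have "v r powr (1 - th) \<le> E * r powr (1 / k + 1) + v 0 powr (1 - th) * 1"
      using mono[of r] r by simp
    also have "\<dots> \<le> E * r powr (1 / k + 1) + v 0 powr (1 - th) * r powr (1 / k + 1)"
      using r k by (intro add_left_mono mult_left_mono ge_one_powr_ge_zero) auto
    finally have le: "v r powr (1 - th) \<le> M0 * r powr (1 / k + 1)"
      by (simp add: M0_def algebra_simps)
    have "v r = (v r powr (1 - th)) powr (1 / (1 - th))"
      using th vpos[of r] r by (simp add: powr_powr)
    also have "\<dots> \<le> (M0 * r powr (1 / k + 1)) powr (1 / (1 - th))"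
      using le th by (intro powr_mono2) auto
    also have "(1 / k + 1) * (1 / (1 - th)) = rate"
      using k sub by (simp add: rate_def th_def divide_simps) 
    then have "(M0 * r powr (1 / k + 1)) powr (1 / (1 - th)) = M0 powr (1 / (1 - th)) * r powr rate"
      using M0 r by (simp only: powr_mult powr_powr)
    finally show ?thesis .
  qed
  then show ?thesis using M0 by (intro that[of "M0 powr (1 / (1 - th))"]) auto
qed

text \<open>The improvement of an eventual upper bound. The values of \<open>v\<close> near the origin contribute only a bounded
amount to \<open>load v\<close>, while the load of the power profile \<open>w\<close> tends to infinity. Up to a factor as close to
\<open>1\<close> as desired, \<open>v \<le> mu w\<close> therefore implies \<open>v' \<le> mu\<^sup>\<theta> w'\<close> for large \<open>r\<close>; the constant of integration is
negligible because \<open>w\<close> is unbounded.\<close>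

lemma asymptotic_step:
  assumes v: "profile v" and pos: "v 0 > 0" and sub: "m < k" and mu: "mu > 0"
    and le: "eventually (\<lambda>r. v r \<le> mu * (amplitude * r powr rate)) at_top"
    and mu': "mu powr (m / k) < mu'"
  shows "eventually (\<lambda>r. v r \<le> mu' * (amplitude * r powr rate)) at_top"
proof -
  let ?w = "\<lambda>r. amplitude * r powr rate"
  note w = power_profile[OF sub]
  have apos: "amplitude > 0" and rpos: "rate > 1" using amplitude_pos rate_pos sub by auto
  obtain R where R: "R > 0" "\<And>r. r \<ge> R \<Longrightarrow> v r \<le> mu * ?w r"
  proof -
    obtain N where "\<forall>r\<ge>N. v r \<le> mu * ?w r" using le by (auto simp: eventually_at_top_linorder)
    then show ?thesis by (intro that[of "max N 1"]) auto
  qed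
  define B where "B = v R"
  have B: "B \<ge> 0" using profileD(3)[OF v] R by (simp add: B_def)
  have load_le: "load v r \<le> mu powr m * load ?w r + c * B powr m / (b + 1)" if r: "r > 0" for r
  proof -
    let ?g = "\<lambda>t. t powr b * ?w (r * t) powr m"
    have "integral {0..1} (\<lambda>t. t powr b * v (r * t) powr m)
       \<le> integral {0..1} (\<lambda>t. mu powr m * ?g t + t powr b * B powr m)"
    proof (rule integral_le)
      show "(\<lambda>t. t powr b * v (r * t) powr m) integrable_on {0..1}"
        using r by (intro integrand_integrable profileD(1) v) auto
      show "(\<lambda>t. mu powr m * ?g t + t powr b * B powr m) integrable_on {0..1}"
        using r integrand_integrable[OF profileD(1)[OF w], of r]
          integrand_integrable[OF admissible_const[OF B], of r]
        by (intro integrable_add integrable_on_mult_right) auto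
      fix t :: real assume t: "t \<in> {0..1}"
      then have rt: "r * t \<ge> 0" using r by simp
      \<comment> \<open>Below \<open>R\<close> the profile is at most \<open>B\<close>, beyond \<open>R\<close> the assumed bound holds.\<close>
      have "v (r * t) powr m \<le> (mu * ?w (r * t)) powr m + B powr m"
      proof (cases "r * t \<ge> R")
        case True
        then have "v (r * t) powr m \<le> (mu * ?w (r * t)) powr m"
          using R(2) m profileD(3)[OF v rt] by (intro powr_mono2) auto
        then show ?thesis by (simp add: add_increasing2)
      next
        case False
        then have "v (r * t) powr m \<le> B powr m"
          unfolding B_def using m rt profileD(3)[OF v rt]
          by (intro powr_mono2 profile_mono[OF v]) auto
        then show ?thesis by (simp add: add_increasing)
      qed
      then have "t powr b * v (r * t) powr m \<le> t powr b * ((mu * ?w (r * t)) powr m + B powr m)"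
        by (rule mult_left_mono) auto
      then show "t powr b * v (r * t) powr m \<le> mu powr m * ?g t + t powr b * B powr m"
        using mu apos by (simp add: powr_mult algebra_simps)
    qed
    also have "\<dots> = mu powr m * integral {0..1} ?g + integral {0..1} (\<lambda>t. t powr b * B powr m)"
      using r integrand_integrable[OF profileD(1)[OF w], of r]
          integrand_integrable[OF admissible_const[OF B], of r]
      by (subst integral_add) (auto intro!: integrable_on_mult_right simp del: integral_mult_left)
    finally have "load v r \<le> c * (mu powr m * integral {0..1} ?g
        + integral {0..1} (\<lambda>t. t powr b * B powr m))"
      unfolding load_def using c by (intro mult_left_mono) auto
    also have "\<dots> = mu powr m * load ?w r + load (\<lambda>_. B) r"
      unfolding load_def by (simp add: algebra_simps)
    finally show ?thesis using r B by (simp add: load_const)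
  qed
  obtain nu where nu: "mu powr (m / k) < nu" "nu < mu'" using dense[OF mu'] by blast
  have nu0: "nu > 0" using nu mu powr_gt_zero[of mu "m / k"] by linarith
  have "(mu powr (m / k)) powr k < nu powr k"
    using nu mu k by (intro powr_less_mono2) auto
  then have gap: "nu powr k - mu powr m > 0"
    using k by (simp add: powr_powr)
  have "filterlim (\<lambda>r. (amplitude * rate) powr k * r powr (rate * m)) at_top at_top"
    using apos rpos m
    by (intro filterlim_tendsto_pos_mult_at_top[OF tendsto_const] powr_filterlim_at_top) auto
  then have "eventually (\<lambda>r. (c * B powr m / (b + 1)) / (nu powr k - mu powr m)
      \<le> (amplitude * rate) powr k * r powr (rate * m)) at_top"
    by (simp add: filterlim_at_top)
  then obtain R1 where R1: "R1 > 0" "\<And>r. r \<ge> R1 \<Longrightarrow> (c * B powr m / (b + 1)) / (nu powr k - mu powr m)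
      \<le> (amplitude * rate) powr k * r powr (rate * m)"
  proof -
    assume "eventually (\<lambda>r. (c * B powr m / (b + 1)) / (nu powr k - mu powr m)
      \<le> (amplitude * rate) powr k * r powr (rate * m)) at_top"
    then obtain N where "\<forall>r\<ge>N. (c * B powr m / (b + 1)) / (nu powr k - mu powr m)
      \<le> (amplitude * rate) powr k * r powr (rate * m)"
      unfolding eventually_at_top_linorder by blast
    then show ?thesis by (intro that[of "max N 1"]) auto
  qed
  have slope_le: "slope v r \<le> nu * slope ?w r" if r: "r \<ge> R1" for r
  proof -
    have r0: "r > 0" using R1 r by simp
    have "(c * B powr m / (b + 1)) \<le> load ?w r * (nu powr k - mu powr m)"
      using R1(2)[OF r] unfolding load_power_profile[OF sub less_imp_le[OF r0]] pos_divide_le_eq[OF gap] .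
    then have "load v r \<le> nu powr k * load ?w r"
      using load_le[OF r0] by (simp add: algebra_simps)
    then have "slope v r \<le> (nu powr k * (r * load ?w r)) powr (1 / k)"
      unfolding slope_def using r0 k load_nonneg[OF profileD(1)[OF v], of r]
      by (intro powr_mono2) (auto simp: mult.left_commute)
    also have "\<dots> = nu * slope ?w r"
      unfolding slope_def using nu0 k r0 load_nonneg[OF profileD(1)[OF w], of r]
      by (subst powr_mult) (auto simp: powr_powr)
    finally show ?thesis .
  qed
  have grow: "v r \<le> v R1 + nu * ?w r" if r: "r \<ge> R1" for r
  proof -
    let ?f = "\<lambda>r. nu * ?w r - v r"
    have "?f R1 \<le> ?f r"
    proof (rule DERIV_nonneg_imp_increasing_open[OF r])
      show "continuous_on {R1..r} ?f"
        using R1 by (intro continuous_on_diff continuous_on_mult_left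
            continuous_on_subset[OF profileD(2)[OF v]] continuous_on_subset[OF profileD(2)[OF w]]) auto
      show "\<exists>y. (?f has_real_derivative y) (at x) \<and> 0 \<le> y" if "R1 < x" "x < r" for x
        using that slope_le[of x] R1
        by (intro exI[of _ "nu * slope ?w x - slope v x"])
           (auto intro!: DERIV_diff DERIV_cmult profileD(4)[OF v] profileD(4)[OF w])
    qed
    moreover have "nu * ?w R1 \<ge> 0" using nu0 apos by simp
    ultimately show ?thesis by linarith
  qed
  have "filterlim ?w at_top at_top"
    using apos rpos
    by (intro filterlim_tendsto_pos_mult_at_top[OF tendsto_const] powr_filterlim_at_top) auto
  then have "eventually (\<lambda>r. v R1 / (mu' - nu) \<le> ?w r) at_top"
    by (simp only: filterlim_at_top)
  then show ?thesis
    using eventually_ge_at_top[of R1]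
  proof eventually_elim
    case (elim r)
    then have "v R1 \<le> (mu' - nu) * ?w r"
      using nu by (simp add: pos_divide_le_eq mult.commute)
    then show ?case using grow[OF elim(2)] by (simp add: algebra_simps)
  qed
qed

text \<open>Comparison with the power profile \<open>w\<close> gives \<open>w \<le> v\<close>. Let \<open>L\<close> be the infimum of the constants \<open>mu\<close> with
eventually \<open>v \<le> mu w\<close>, a nonempty set by \<open>profile_upper_bound\<close>. If \<open>L > 1\<close>, there would be such a \<open>mu\<close>
with \<open>mu\<^sup>\<theta> < L\<close>, and \<open>asymptotic_step\<close> would produce an eventual bound below \<open>L\<close>.\<close>

theorem profile_asymptotics:
  assumes v: "profile v" and pos: "v 0 > 0" and sub: "m < k"
  shows "((\<lambda>r. v r / r powr rate) \<longlongrightarrow> amplitude) at_top"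
proof -
  let ?w = "\<lambda>r. amplitude * r powr rate"
  note w = power_profile[OF sub]
  have apos: "amplitude > 0" and rpos: "rate > 1" using amplitude_pos rate_pos sub by auto
  define th where "th = m / k"
  have th: "0 < th" "th < 1" using m k sub by (auto simp: th_def)
  define S where "S = {mu. mu > 0 \<and> eventually (\<lambda>r. v r \<le> mu * ?w r) at_top}"
  have lower: "?w r \<le> v r" if "r \<ge> 0" for r
    using comparison[OF v w _ pos sub that] pos by simp
  have S_ge: "1 \<le> mu" if "mu \<in> S" for mu
  proof -
    have "eventually (\<lambda>r. v r \<le> mu * ?w r) at_top" using that by (simp add: S_def)
    then have "eventually (\<lambda>r. r > 0 \<and> v r \<le> mu * ?w r) at_top"
      using eventually_gt_at_top[of 0] by eventually_elim auto
    then obtain r where r: "r > 0" "v r \<le> mu * ?w r"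
      using eventually_happens by force
    have "1 * ?w r \<le> mu * ?w r" using lower[of r] r by linarith
    moreover have "?w r > 0" using r apos by simp
    ultimately show ?thesis by (simp only: mult_le_cancel_right_pos)
  qed
  obtain M where M: "M > 0" "\<And>r. r \<ge> 1 \<Longrightarrow> v r \<le> M * r powr rate"
    using profile_upper_bound[OF v pos sub] by blast
  have "M / amplitude \<in> S"
    unfolding S_def using M apos by (auto intro!: eventually_mono[OF eventually_ge_at_top[of 1]])
  then have S: "S \<noteq> {}" "bdd_below S" using S_ge by (auto intro!: bdd_belowI)
  have "Inf S \<le> 1"
  proof (rule ccontr)
    assume "\<not> Inf S \<le> 1"
    then have L: "Inf S > 1" by simp
    have "Inf S powr 1 < Inf S powr (1 / th)"
      using L th by (intro powr_less_mono) auto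
    then have "Inf S < Inf S powr (1 / th)" using L by simp
    then obtain mu where mu: "mu \<in> S" "mu < Inf S powr (1 / th)"
      using cInf_lessD[OF S(1)] by blast
    have mu0: "mu > 0" using mu by (simp add: S_def)
    have "mu powr th < (Inf S powr (1 / th)) powr th"
      using mu mu0 th by (intro powr_less_mono2) auto
    then have "mu powr th < Inf S" using th L by (simp add: powr_powr)
    then obtain mu' where mu': "mu powr th < mu'" "mu' < Inf S" using dense by blast
    have "mu' > 0" using mu' powr_gt_zero[of mu th] mu0 by linarith
    then have "mu' \<in> S"
      using asymptotic_step[OF v pos sub mu0 _ mu'(1)[unfolded th_def]] mu by (simp add: S_def)
    then show False using cInf_lower[OF _ S(2)] mu' by fastforce
  qed
  then have upper: "eventually (\<lambda>r. v r < (1 + e) * ?w r) at_top" if "e > 0" for e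
  proof -
    obtain mu where mu: "mu \<in> S" "mu < 1 + e"
      using cInf_lessD[OF S(1), of "1 + e"] \<open>Inf S \<le> 1\<close> \<open>e > 0\<close> by auto
    then have "eventually (\<lambda>r. v r \<le> mu * ?w r) at_top" by (simp add: S_def)
    then show ?thesis using eventually_gt_at_top[of 0]
    proof eventually_elim
      case (elim r)
      have "?w r > 0" using elim apos by simp
      then have "mu * ?w r < (1 + e) * ?w r" using mu by (simp only: mult_strict_right_mono)
      then show ?case using elim by linarith
    qed
  qed
  show ?thesis
  proof (rule order_tendstoI)
    fix a assume a: "a < amplitude"
    show "eventually (\<lambda>r. a < v r / r powr rate) at_top"
      using eventually_gt_at_top[of 0]
    proof eventually_elim
      case (elim r)
      have "a * r powr rate < amplitude * r powr rate" using a elim by simp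
      also have "\<dots> \<le> v r" using lower[of r] elim by simp
      finally show ?case using elim by (simp add: pos_less_divide_eq)
    qed
  next
    fix a assume a: "amplitude < a"
    have "a / amplitude - 1 > 0" using a apos by (simp add: field_simps)
    from upper[OF this] show "eventually (\<lambda>r. v r / r powr rate < a) at_top"
      using eventually_gt_at_top[of 0]
    proof eventually_elim
      case (elim r)
      then have "v r < a * r powr rate" using apos by simp
      then show ?case using elim by (simp add: pos_divide_less_eq)
    qed
  qed
qed

end

section \<open>Blow-up in the superlinear case\<close>

context emden
begin

text \<open>On \<open>[r + h/2, r + h]\<close> the part of the integral over \<open>[r, s]\<close> alone bounds the slope from below: there
\<open>v \<ge> v(r)\<close>, the interval has length at least \<open>h/2\<close>, and the ratio of the weights is at least \<open>2^(-b)\<close>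
since \<open>s \<le> 2 r\<close>.\<close>

lemma profile_growth:
  assumes v: "profile v" and h: "0 < h" "h \<le> r"
  shows "v r + h / 2 * (c / 2 powr (b + 1) * h * v r powr m) powr (1 / k) \<le> v (r + h)"
proof -
  define K where "K = (c / 2 powr (b + 1) * h * v r powr m) powr (1 / k)"
  have r: "r > 0" using h by simp
  have slope_ge: "K \<le> slope v s" if s: "r + h / 2 \<le> s" "s \<le> r + h" for s
  proof -
    have s0: "s > 0" "r < s" using s r h by auto
    let ?g = "\<lambda>t. t powr b * v (s * t) powr m"
    have int: "?g integrable_on {0..1}"
      using s0 by (intro integrand_integrable profileD(1)[OF v]) auto
    have rs: "1 / 2 \<le> r / s" "r / s \<le> 1" using s h r by (auto simp: field_simps)
    have int2: "?g integrable_on {r / s..1}"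
      by (rule integrable_on_subinterval[OF int]) (use s0 r in auto)
    have "(1 - r / s) * ((1 / 2) powr b * v r powr m)
        = integral {r / s..1} (\<lambda>_. (1 / 2) powr b * v r powr m)"
      using rs by simp
    also have "\<dots> \<le> integral {r / s..1} ?g"
    proof (rule integral_le[OF _ int2])
      fix t assume t: "t \<in> {r / s..1}"
      have "r \<le> s * t" using t s0 by (simp add: pos_divide_le_eq mult.commute)
      moreover have "1 / 2 \<le> t" using order_trans[OF rs(1), of t] t by simp
      ultimately show "(1 / 2) powr b * v r powr m \<le> t powr b * v (s * t) powr m"
        using b m r profileD(3)[OF v, of r]
        by (intro mult_mono powr_mono2 profile_mono[OF v]) auto
    qed (rule integrable_const_ivl)
    also have "\<dots> \<le> integral {0..1} ?g"
      by (rule integral_subset_le[OF _ int2 int]) (use s0 r in auto)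
    finally have "c * ((1 - r / s) * ((1 / 2) powr b * v r powr m)) \<le> load v s"
      unfolding load_def using c by (intro mult_left_mono) auto
    then have "s * (c * ((1 - r / s) * ((1 / 2) powr b * v r powr m))) \<le> s * load v s"
      using s0 by (intro mult_left_mono) auto
    moreover have "s * (c * ((1 - r / s) * ((1 / 2) powr b * v r powr m)))
        = (s - r) * (c / 2 powr b * v r powr m)"
      using s0 by (simp add: powr_divide field_simps)
    moreover have "(h / 2) * (c / 2 powr b * v r powr m) \<le> (s - r) * (c / 2 powr b * v r powr m)"
      using s c by (intro mult_right_mono) auto
    moreover have "(h / 2) * (c / 2 powr b * v r powr m) = c / 2 powr (b + 1) * h * v r powr m"
      by (simp add: powr_add mult_ac)
    ultimately have "c / 2 powr (b + 1) * h * v r powr m \<le> s * load v s" by linarith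
    then show ?thesis
      unfolding K_def slope_def using c h k by (intro powr_mono2) auto
  qed
  let ?f = "\<lambda>s. v s - K * s"
  have "?f (r + h / 2) \<le> ?f (r + h)"
  proof (rule DERIV_nonneg_imp_increasing_open[where f = ?f])
    show "continuous_on {r + h / 2..r + h} ?f"
      by (intro continuous_intros continuous_on_subset[OF profileD(2)[OF v]]) (use h in auto)
    show "\<exists>y. (?f has_real_derivative y) (at x) \<and> 0 \<le> y" if "r + h / 2 < x" "x < r + h" for x
      using that slope_ge[of x] h
      by (intro exI[of _ "slope v x - K"]) (auto intro!: derivative_eq_intros profileD(4)[OF v])
  qed (use h in auto)
  moreover have "v r \<le> v (r + h / 2)" using h by (intro profile_mono[OF v]) auto
  ultimately show ?thesis unfolding K_def[symmetric] by (simp add: algebra_simps)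
qed

text \<open>By \<open>profile_growth\<close> a profile with value at least \<open>V\<close> doubles it within the distance
\<open>h = K V^(-d)\<close>, \<open>d = (m - k) / (k + 1) > 0\<close>; both constants are chosen so that the guaranteed increment
equals \<open>V\<close>. Successive doublings take distances that decrease geometrically with ratio \<open>2^(-d) < 1\<close>, so
the values would exceed every bound before a finite radius. Starting at the radius \<open>h0\<close> ensures the
condition \<open>h \<le> r\<close> of \<open>profile_growth\<close>.\<close>

theorem no_profile:
  assumes v: "profile v" and pos: "v 0 > 0" and super: "m > k"
  shows False
proof -
  define A where "A = v 0"
  define D where "D = c / 2 powr (b + 1)"
  define d where "d = (m - k) / (k + 1)"
  define K where "K = (2 / D powr (1 / k)) powr (k / (k + 1))"
  have A: "A > 0" using pos by (simp add: A_def)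
  have D: "D > 0" using c by (simp add: D_def)
  have d: "d > 0" using super k by (simp add: d_def)
  have K: "K > 0" using D by (simp add: K_def)
  have gain: "h / 2 * (D * h * V powr m) powr (1 / k) = V" if "V > 0" "h = K * V powr (- d)" for h V
  proof -
    have "K powr ((k + 1) / k) = 2 / D powr (1 / k)"
      using k D by (simp add: K_def powr_powr)
    moreover have "h powr ((k + 1) / k) = K powr ((k + 1) / k) * V powr (- d * ((k + 1) / k))"
      using that K by (simp add: powr_mult powr_powr)
    moreover have "- d * ((k + 1) / k) = 1 - m / k"
    proof -
      have "- d * (k + 1) = k - m" using k by (simp add: d_def)
      then show ?thesis using k by (simp add: diff_divide_distrib)
    qed
    ultimately have hp: "h powr ((k + 1) / k) = 2 / D powr (1 / k) * V powr (1 - m / k)"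
      by simp
    have h: "h > 0" using that K by simp
    have "h powr ((k + 1) / k) = h * h powr (1 / k)"
      using h k by (simp add: powr_mult_base add_divide_distrib)
    then have "h / 2 * (D * h * V powr m) powr (1 / k)
        = h powr ((k + 1) / k) / 2 * D powr (1 / k) * V powr (m / k)"
      using h D that by (simp add: powr_mult powr_powr)
    also have "\<dots> = V powr (1 - m / k) * V powr (m / k)"
      unfolding hp using D by simp
    also have "\<dots> = V" using that by (simp flip: powr_add)
    finally show ?thesis .
  qed
  define h0 where "h0 = K * A powr (- d)"
  define q where "q = 2 powr (- d)"
  have q: "0 < q" "q < 1" using d by (auto simp: q_def powr_minus field_simps)
  have h0: "h0 > 0" using K A by (simp add: h0_def)
  \<comment> \<open>\<open>x n\<close> is the radius reached after \<open>n\<close> doublings; the leading \<open>h0\<close> is the starting radius.\<close>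
  define x where "x n = h0 + h0 * (\<Sum>j<n. q ^ j)" for n
  have x_ge: "x n \<ge> h0" for n
    using h0 q by (auto simp: x_def intro!: mult_nonneg_nonneg sum_nonneg)
  have double: "2 ^ n * A \<le> v (x n)" for n
  proof (induction n)
    case 0
    then show ?case using profile_mono[OF v, of 0 "x 0"] x_ge[of 0] h0 by (simp add: A_def)
  next
    case (Suc n)
    define V where "V = 2 ^ n * A"
    define h where "h = h0 * q ^ n"
    have V: "V > 0" using A by (simp add: V_def)
    have "V powr (- d) = q ^ n * A powr (- d)"
      using A by (simp add: V_def q_def powr_mult powr_realpow[symmetric] powr_powr mult.commute)
    then have hV: "h = K * V powr (- d)" by (simp add: h_def h0_def)
    have "h \<le> h0 * 1"
      unfolding h_def using q h0 by (intro mult_left_mono power_le_one) auto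
    then have "h \<le> x n" using x_ge[of n] by linarith
    moreover have "0 < h" using h0 q by (simp add: h_def)
    ultimately have h: "0 < h" "h \<le> x n" by auto
    have "2 ^ Suc n * A = V + h / 2 * (D * h * V powr m) powr (1 / k)"
      using gain[OF V hV] by (simp add: V_def)
    also have "\<dots> \<le> v (x n) + h / 2 * (D * h * v (x n) powr m) powr (1 / k)"
      using Suc h D V k m unfolding V_def[symmetric]
      by (intro add_mono mult_left_mono powr_mono2) auto
    also have "\<dots> \<le> v (x n + h)"
      using profile_growth[OF v h] by (simp add: D_def)
    also have "x n + h = x (Suc n)" by (simp add: x_def h_def algebra_simps)
    finally show ?case .
  qed
  define X where "X = h0 + h0 * (1 / (1 - q))"
  have "x n \<le> X" for n
  proof -
    have "(\<Sum>j<n. q ^ j) = (1 - q ^ n) / (1 - q)"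
      using q by (simp add: sum_gp_strict)
    also have "\<dots> \<le> 1 / (1 - q)" using q by (intro divide_right_mono) auto
    finally show ?thesis unfolding x_def X_def using h0 by (intro add_left_mono mult_left_mono) auto
  qed
  then have "2 ^ n * A \<le> v X" for n
    using double[of n] profile_mono[OF v, of "x n" X] x_ge[of n] h0 by (meson less_imp_le order_trans)
  moreover obtain n where "v X / A < 2 ^ n"
    using real_arch_pow[of 2 "v X / A"] by auto
  then have "v X < 2 ^ n * A" using A by (simp add: pos_divide_less_eq)
  ultimately show False by (meson not_le)
qed

end

section \<open>Differentiability of profiles\<close>

context emden
begin

lemma load_pos:
  assumes "profile v" "v 0 > 0" "r \<ge> 0"
  shows "load v r > 0"
proof -
  have "0 < load (\<lambda>_. v 0) r"
    using assms c b by (simp add: load_const)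
  also have "\<dots> \<le> load v r"
    using assms by (intro load_mono admissible_const profileD(1) profile_mono[OF assms(1)]) auto
  finally show ?thesis .
qed

lemma slope_pos: "profile v \<Longrightarrow> v 0 > 0 \<Longrightarrow> r > 0 \<Longrightarrow> slope v r > 0"
  using load_pos[of v r] by (simp add: slope_def)

lemma load_0: "v 0 \<ge> 0 \<Longrightarrow> load v 0 = c * v 0 powr m / (b + 1)"
  using load_const[of "v 0" 0] by (simp add: load_def)

text \<open>The substitution \<open>s = r t\<close>, in a form that serves both directions: \<open>Z\<close> is an indefinite integral
for a given profile, and \<open>r\<^sup>b v'\<^sup>k\<close> when the integral equation is derived from the differential equation.\<close>

lemma load_eq_primitive:
  assumes cont: "continuous_on {0..} Z" and Z0: "Z 0 = 0"
    and Z: "\<And>s. s > 0 \<Longrightarrow> (Z has_real_derivative c * (s powr b * v s powr m)) (at s)"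
    and r: "r > 0"
  shows "load v r = Z r / r powr (b + 1)"
proof -
  let ?C = "c * r powr (b + 1)"
  have "((\<lambda>t. ?C * (t powr b * v (r * t) powr m)) has_integral Z (r * 1) - Z (r * 0)) {0..1}"
  proof (rule fundamental_theorem_of_calculus_interior)
    show "continuous_on {0..1} (\<lambda>t. Z (r * t))"
      by (rule continuous_on_compose2[OF cont, of _ "\<lambda>t. r * t"])
         (use r in \<open>auto intro!: continuous_intros\<close>)
    fix t :: real assume t: "t \<in> {0<..<1}"
    have "((\<lambda>t. Z (r * t)) has_real_derivative c * ((r * t) powr b * v (r * t) powr m) * r) (at t)"
      by (rule DERIV_chain2[OF Z]) (use r t in \<open>auto intro!: derivative_eq_intros\<close>)
    moreover have "c * ((r * t) powr b * v (r * t) powr m) * r = ?C * (t powr b * v (r * t) powr m)"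
      using r t by (simp add: powr_mult powr_add)
    ultimately show "((\<lambda>t. Z (r * t)) has_vector_derivative ?C * (t powr b * v (r * t) powr m)) (at t)"
      by (simp add: has_real_derivative_iff_has_vector_derivative)
  qed simp
  from integral_unique[OF this]
  have "?C * integral {0..1} (\<lambda>t. t powr b * v (r * t) powr m) = Z r" using Z0 by simp
  then show ?thesis using r unfolding load_def by (simp add: field_simps)
qed

lemma load_has_derivative:
  assumes v: "admissible v" and r: "r > 0"
  shows "(load v has_real_derivative (c * v r powr m - (b + 1) * load v r) / r) (at r)"
proof -
  let ?f = "\<lambda>s. c * (s powr b * v s powr m)"
  let ?Z = "\<lambda>s. integral {0..s} ?f"
  have cont: "continuous_on {0..} ?f"
    using v b m by (intro continuous_on_mult continuous_on_powr' continuous_intros) (auto simp: admissible_def)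
  have int: "?f integrable_on {0..s}" for s
    by (intro integrable_continuous_real continuous_on_subset[OF cont]) auto
  have Z: "(?Z has_real_derivative ?f s) (at s)" if "s > 0" for s
  proof -
    have "(?Z has_real_derivative ?f s) (at s within {0..s + 1})"
      by (rule integral_has_real_derivative)
         (use that in \<open>auto intro: continuous_on_subset[OF cont]\<close>)
    moreover have "at s within {0..s + 1} = at s"
      by (rule at_within_interior) (use that in auto)
    ultimately show ?thesis by simp
  qed
  have load_eq: "load v s = ?Z s / s powr (b + 1)" if "s > 0" for s
    by (rule load_eq_primitive[OF continuous_on_indefinite_integral[OF int] _ Z that]) simp_all
  define E where "E = r powr b"
  have E: "E > 0" "r powr (b + 1) = E * r" using r by (auto simp: E_def powr_add)
  have "((\<lambda>s. ?Z s / s powr (b + 1)) has_real_derivative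
      (?f r * r powr (b + 1) - ?Z r * ((b + 1) * r powr b)) / (r powr (b + 1) * r powr (b + 1))) (at r)"
    using r has_real_derivative_powr[OF r, of "b + 1"] by (intro DERIV_divide Z) auto
  moreover have "(c * (E * V) * (E * r) - Y * ((b + 1) * E)) / (E * r * (E * r))
      = (c * V - (b + 1) * (Y / (E * r))) / r" for V Y
    using E r by (simp add: field_simps)
  ultimately have "((\<lambda>s. ?Z s / s powr (b + 1)) has_real_derivative
      (c * v r powr m - (b + 1) * load v r) / r) (at r)"
    unfolding load_eq[OF r] E(2) E_def[symmetric] by (simp only:)
  then show ?thesis
    by (rule has_field_derivative_transform_within_open[where S = "{0<..}"])
       (use r load_eq in auto)
qed

text \<open>General exponents are needed because \<open>slope v\<close> itself enters the Hessian and its power \<open>p - 1\<close> is the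
flux of the \<open>p\<close>-Laplacian.\<close>

lemma slope_power_has_derivative:
  assumes v: "profile v" and pos: "v 0 > 0" and r: "r > 0"
  shows "((\<lambda>s. slope v s powr e) has_real_derivative
    e / k * slope v r powr e / r * (c * v r powr m / load v r - b)) (at r)"
proof -
  let ?Q = "\<lambda>s. s * load v s"
  have J: "load v s > 0" if "s \<ge> 0" for s using load_pos[OF v pos that] .
  have Q: "(?Q has_real_derivative 1 * load v r + (c * v r powr m - (b + 1) * load v r) / r * r) (at r)"
    by (intro DERIV_mult DERIV_ident load_has_derivative profileD(1)[OF v] r)
  have Qr: "?Q r > 0" using r J[of r] by simp
  have eq: "slope v s powr e = ?Q s powr (e / k)" for s
    by (simp add: slope_def powr_powr)
  have "((\<lambda>s. ?Q s powr (e / k)) has_real_derivative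
      e / k * ?Q r powr (e / k - 1) * (1 * load v r + (c * v r powr m - (b + 1) * load v r) / r * r)) (at r)"
    using DERIV_fun_powr[OF Q Qr, of "e / k"] by simp
  moreover have "?Q r powr (e / k - 1) = slope v r powr e / (r * load v r)"
    using Qr by (simp add: eq powr_diff)
  moreover have "1 * load v r + (c * v r powr m - (b + 1) * load v r) / r * r
      = load v r * (c * v r powr m / load v r - b)"
    using r J[of r] by (simp add: field_simps)
  ultimately have "((\<lambda>s. ?Q s powr (e / k)) has_real_derivative
      e / k * (slope v r powr e / (r * load v r)) * (load v r * (c * v r powr m / load v r - b))) (at r)"
    by (simp only:)
  moreover have "e / k * (S / (r * load v r)) * (load v r * X) = e / k * S / r * X" for S X
    using J[of r] r by simp
  ultimately have "((\<lambda>s. ?Q s powr (e / k)) has_real_derivative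
      e / k * slope v r powr e / r * (c * v r powr m / load v r - b)) (at r)"
    by (simp only:)
  then show ?thesis unfolding eq[abs_def] .
qed

lemma slope_has_derivative:
  assumes v: "profile v" and pos: "v 0 > 0" and r: "r > 0"
  shows "(slope v has_real_derivative slope v r / (k * r) * (c * v r powr m / load v r - b)) (at r)"
  using slope_power_has_derivative[OF assms, of 1] by (simp add: slope_nonneg)

lemma profile_derivative_0:
  assumes v: "profile v"
  shows "(v has_real_derivative 0) (at 0 within {0..})"
proof -
  have eq: "v r = v 0 + integral {0..r} (slope v)" if r: "r \<ge> 0" for r
  proof -
    have "(slope v has_integral v r - v 0) {0..r}"
      using r profileD(4)[OF v] continuous_on_subset[OF profileD(2)[OF v]]
      by (intro fundamental_theorem_of_calculus_interior)
         (auto simp: has_real_derivative_iff_has_vector_derivative)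
    then show ?thesis by (simp add: integral_unique)
  qed
  have "((\<lambda>r. integral {0..r} (slope v)) has_real_derivative slope v 0) (at 0 within {0..1})"
    by (rule integral_has_real_derivative)
       (auto intro: continuous_on_subset[OF continuous_on_slope[OF profileD(1)[OF v]]])
  then have "((\<lambda>r. v 0 + integral {0..r} (slope v)) has_real_derivative 0) (at 0 within {0..1})"
    by (auto intro!: derivative_eq_intros simp: slope_def)
  moreover have "at 0 within {0..1} = at (0 :: real) within {0..}"
    by (rule at_within_nhd[of 0 "{..<1}"]) auto
  ultimately have "((\<lambda>r. v 0 + integral {0..r} (slope v)) has_real_derivative 0) (at 0 within {0..})"
    by simp
  then show ?thesis
    by (rule has_field_derivative_transform_within[of _ _ _ _ 1]) (auto intro: eq[symmetric])
qed

end

section \<open>Derivatives of radial functions\<close>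

lemma grad_eqI:
  assumes "(u has_derivative D) (at x)"
  shows "grad u x = (\<chi> j. D (axis j 1))"
  using frechet_derivative_at[OF assms] by (simp add: grad_def)

lemma radial_has_derivative:
  fixes x :: "real ^ 'n::finite"
  assumes "(v has_real_derivative d) (at (norm x))" "x \<noteq> 0"
  shows "((\<lambda>x. v (norm x)) has_derivative (\<lambda>h. d * (x \<bullet> h / norm x))) (at x)"
proof -
  have "(norm has_derivative (\<lambda>h. x \<bullet> h / norm x)) (at x)"
    using has_derivative_norm[OF assms(2)]
    by (simp add: sgn_div_norm inverse_eq_divide inner_commute)
  from has_derivative_compose[OF this assms(1)[unfolded has_field_derivative_def]]
  show ?thesis by simp
qed

lemma grad_radial:
  fixes x :: "real ^ 'n::finite"
  assumes "(v has_real_derivative d) (at (norm x))" "x \<noteq> 0"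
  shows "grad (\<lambda>x. v (norm x)) x = (d / norm x) *\<^sub>R x"
  unfolding grad_eqI[OF radial_has_derivative[OF assms]]
  by (simp add: vec_eq_iff inner_axis)

text \<open>Applied along each coordinate axis, this shows that a differentiable radial function has gradient zero
at the origin.\<close>

lemma even_derivative_zero:
  fixes g :: "real \<Rightarrow> real"
  assumes "(g has_real_derivative d) (at 0)" "\<And>t. g (- t) = g t"
  shows "d = 0"
proof -
  have "((\<lambda>t. g (- t)) has_real_derivative d * (- 1)) (at 0)"
    using assms(1) by (intro DERIV_chain2[of g]) (auto intro!: derivative_eq_intros)
  then have "d = d * (- 1)" using assms(1) unfolding assms(2) by (rule DERIV_unique[rotated])
  then show ?thesis by simp
qed

lemma has_derivative_axis:
  fixes u :: "real ^ 'n::finite \<Rightarrow> real"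
  assumes "u differentiable (at (x + t *\<^sub>R axis j 1))"
  shows "((\<lambda>t. u (x + t *\<^sub>R axis j 1)) has_real_derivative grad u (x + t *\<^sub>R axis j 1) $ j) (at t)"
proof -
  let ?y = "x + t *\<^sub>R axis j 1"
  have "(u has_derivative frechet_derivative u (at ?y)) (at ?y)"
    using assms by (simp add: frechet_derivative_works)
  moreover have "((\<lambda>t. x + t *\<^sub>R axis j 1) has_derivative (\<lambda>h. h *\<^sub>R axis j 1)) (at t)"
    by (auto intro!: derivative_eq_intros)
  ultimately have "((\<lambda>t. u (x + t *\<^sub>R axis j 1)) has_derivative
      (\<lambda>h. frechet_derivative u (at ?y) (h *\<^sub>R axis j 1))) (at t)"
    using has_derivative_compose by blast
  moreover have "frechet_derivative u (at ?y) (h *\<^sub>R axis j 1) = grad u ?y $ j * h" for h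
    using linear_frechet_derivative[OF assms] by (simp add: grad_def linear_scale)
  ultimately show ?thesis by (simp add: has_field_derivative_def)
qed

text \<open>The profile function \<open>v\<close> is obtained by restricting \<open>u\<close> to a whole coordinate axis, so it is an even
\<open>C\<^sup>1\<close> function on the line and no one-sided derivatives occur.\<close>

lemma radial_function_derivative:
  fixes u :: "real ^ 'n::finite \<Rightarrow> real"
  assumes C1: "C1_on UNIV u" and rad: "radially_symmetric u"
  obtains v v' where "\<And>x. u x = v (norm x)" "\<And>r. (v has_real_derivative v' r) (at r)"
    "continuous_on UNIV v'" "v' 0 = 0"
    "\<And>x. x \<noteq> 0 \<Longrightarrow> grad u x = (v' (norm x) / norm x) *\<^sub>R x"
proof -
  fix i :: 'n
  define v where "v r = u (r *\<^sub>R axis i 1)" for r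
  define v' where "v' r = grad u (r *\<^sub>R axis i 1) $ i" for r
  have diff: "u differentiable (at x)" for x using C1 by (simp add: C1_on_def)
  have uv: "u x = v (norm x)" for x
  proof -
    have "norm x = norm (norm x *\<^sub>R axis i 1 :: real ^ 'n)" by simp
    then show ?thesis using rad unfolding radially_symmetric_def v_def by blast
  qed
  have der: "(v has_real_derivative v' r) (at r)" for r
    using has_derivative_axis[of u 0 r i] diff unfolding v_def[abs_def] v'_def by simp
  have "continuous_on UNIV (\<lambda>r. grad u (r *\<^sub>R axis i 1))"
    using C1 by (auto simp: C1_on_def intro!: continuous_on_compose2[of UNIV "grad u"] continuous_intros)
  then have cont: "continuous_on UNIV v'"
    unfolding v'_def by (intro continuous_intros)
  have "grad u 0 $ j = 0" for j
  proof (rule even_derivative_zero)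
    show "((\<lambda>t. u (0 + t *\<^sub>R axis j 1)) has_real_derivative grad u 0 $ j) (at 0)"
      using has_derivative_axis[of u 0 0 j] diff by simp
    show "u (0 + - t *\<^sub>R axis j 1) = u (0 + t *\<^sub>R axis j 1)" for t
      by (simp add: uv)
  qed
  then have g0: "grad u 0 = 0" by (simp add: vec_eq_iff)
  have gx: "grad u x = (v' (norm x) / norm x) *\<^sub>R x" if "x \<noteq> 0" for x
  proof -
    have "u = (\<lambda>x. v (norm x))" using uv by blast
    then show ?thesis using grad_radial[OF der that] by simp
  qed
  show ?thesis
    by (rule that[OF uv der cont _ gx]) (simp_all add: v'_def g0)
qed

lemma filterlim_norm_at_0: "filterlim norm (at 0 within {0..}) (at (0 :: 'a :: real_normed_vector))"
  unfolding filterlim_at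
  by (auto intro!: tendsto_norm_zero simp: eventually_at_filter)

lemma radial_has_derivative_0:
  fixes v :: "real \<Rightarrow> real"
  assumes "(v has_real_derivative 0) (at 0 within {0..})"
  shows "((\<lambda>x :: 'a :: real_normed_vector. v (norm x)) has_derivative (\<lambda>h. 0)) (at 0)"
proof -
  have "((\<lambda>t. (v t - v 0) / (t - 0)) \<longlongrightarrow> 0) (at 0 within {0..})"
    using assms by (simp add: has_field_derivative_iff)
  then have "((\<lambda>h :: 'a. (v (norm h) - v 0) / (norm h - 0)) \<longlongrightarrow> 0) (at 0)"
    using filterlim_norm_at_0 by (rule filterlim_compose)
  then have "((\<lambda>h :: 'a. norm ((v (norm h) - v 0) / (norm h - 0))) \<longlongrightarrow> 0) (at 0)"
    by (rule tendsto_norm_zero)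
  then show ?thesis by (simp add: has_derivative_at)
qed

lemma radial_field_has_derivative:
  fixes x :: "real ^ 'n::finite"
  assumes "(g has_real_derivative d) (at (norm x))" "x \<noteq> 0"
  shows "((\<lambda>x. g (norm x) *\<^sub>R x) has_derivative
    (\<lambda>h. g (norm x) *\<^sub>R h + (d * (x \<bullet> h / norm x)) *\<^sub>R x)) (at x)"
  using has_derivative_scaleR[OF radial_has_derivative[OF assms] has_derivative_ident[of "at x"]]
  by simp

lemma radial_field_has_derivative_0:
  fixes g :: "real \<Rightarrow> real"
  assumes "(g \<longlongrightarrow> g0) (at 0 within {0..})"
  shows "((\<lambda>x :: 'a :: real_normed_vector. g (norm x) *\<^sub>R x) has_derivative (\<lambda>h. g0 *\<^sub>R h)) (at 0)"
proof -
  have "((\<lambda>h :: 'a. g (norm h)) \<longlongrightarrow> g0) (at 0)"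
    using assms filterlim_norm_at_0 by (rule filterlim_compose)
  then have "((\<lambda>h :: 'a. \<bar>g (norm h) - g0\<bar>) \<longlongrightarrow> 0) (at 0)"
    by (simp add: LIM_zero tendsto_rabs_zero)
  then have "((\<lambda>h :: 'a. norm (g (norm h) *\<^sub>R h - g0 *\<^sub>R h) / norm h) \<longlongrightarrow> 0) (at 0)"
    by (rule Lim_transform_eventually)
       (auto simp: eventually_at_filter simp flip: scaleR_diff_left)
  then show ?thesis by (simp add: has_derivative_at bounded_linear_scaleR_right)
qed

lemma has_divergence_of_derivative:
  fixes V :: "real ^ 'n::finite \<Rightarrow> real ^ 'n"
  assumes "(V has_derivative V') (at x)" "d = (\<Sum>i\<in>UNIV. V' (axis i 1) $ i)"
  shows "has_divergence V d x"
  unfolding has_divergence_def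
proof (intro exI conjI allI)
  show "d = (\<Sum>i\<in>UNIV. V' (axis i 1) $ i)" by fact
  fix i :: 'n
  have "((\<lambda>t. x + t *\<^sub>R axis i 1) has_derivative (\<lambda>h. h *\<^sub>R axis i 1)) (at 0)"
    by (auto intro!: derivative_eq_intros)
  then have "((\<lambda>t. V (x + t *\<^sub>R axis i 1)) has_derivative (\<lambda>h. V' (h *\<^sub>R axis i 1))) (at 0)"
    by (rule has_derivative_compose) (use assms(1) in simp)
  then have "((\<lambda>t. V (x + t *\<^sub>R axis i 1) $ i) has_derivative (\<lambda>h. V' (h *\<^sub>R axis i 1) $ i)) (at 0)"
    by (rule bounded_linear.has_derivative[OF bounded_linear_vec_nth])
  moreover have "V' (h *\<^sub>R axis i 1) $ i = V' (axis i 1) $ i * h" for h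
    using assms(1) by (simp add: has_derivative_linear linear_scale)
  ultimately show "((\<lambda>t. V (x + t *\<^sub>R axis i 1) $ i) has_real_derivative V' (axis i 1) $ i) (at 0)"
    by (simp add: has_field_derivative_def)
qed

lemma has_divergence_radial_field:
  fixes x :: "real ^ 'n::finite"
  assumes "(g has_real_derivative d) (at (norm x))" "x \<noteq> 0"
  shows "has_divergence (\<lambda>x. g (norm x) *\<^sub>R x) (norm x * d + real CARD('n) * g (norm x)) x"
proof (rule has_divergence_of_derivative[OF radial_field_has_derivative[OF assms]])
  have "(\<Sum>i\<in>UNIV. x $ i * x $ i) = norm x * norm x"
    using power2_norm_eq_inner[of x] by (simp add: inner_vec_def power2_eq_square)
  then have "(\<Sum>i\<in>UNIV. d / norm x * (x $ i * x $ i)) = norm x * d"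
    using assms(2) unfolding sum_distrib_left[symmetric] by simp
  then show "norm x * d + real CARD('n) * g (norm x) =
      (\<Sum>i\<in>UNIV. (g (norm x) *\<^sub>R axis i 1 + (d * (x \<bullet> axis i 1 / norm x)) *\<^sub>R x) $ i)"
    by (simp add: sum.distrib inner_axis mult_ac)
qed

text \<open>The derivative of the field \<open>g(|x|) x\<close>, where \<open>e(r) = r g'(r)\<close>. Scaling \<open>g'\<close> by \<open>r\<close> separates the bounded
direction cosines \<open>x\<^sub>i / |x|\<close> from a factor \<open>e\<close> that can be continuous at the origin; since \<open>0 / 0 = 0\<close>,
the formula gives \<open>g(0)\<close> times the identity matrix at \<open>x = 0\<close>.\<close>

definition radial_hessian :: "(real \<Rightarrow> real) \<Rightarrow> (real \<Rightarrow> real) \<Rightarrow> real ^ 'n \<Rightarrow> real ^ 'n ^ 'n" where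
  "radial_hessian g e x = (\<chi> i j. e (norm x) * (x $ i / norm x) * (x $ j / norm x)
     + (if i = j then g (norm x) else 0))"

lemma radial_hessian_mult:
  fixes x h :: "real ^ 'n::finite"
  shows "radial_hessian g e x *v h = g (norm x) *\<^sub>R h + (e (norm x) / norm x * (x \<bullet> h / norm x)) *\<^sub>R x"
proof (rule vec_eq_iff[THEN iffD2], rule allI)
  fix i
  have "(radial_hessian g e x *v h) $ i
      = (\<Sum>j\<in>UNIV. e (norm x) / norm x * x $ i / norm x * (x $ j * h $ j)
          + (if i = j then g (norm x) * h $ j else 0))"
    unfolding radial_hessian_def matrix_vector_mult_def
    by (auto intro!: sum.cong simp: algebra_simps)
  also have "\<dots> = e (norm x) / norm x * x $ i / norm x * (x \<bullet> h) + g (norm x) * h $ i"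
    unfolding sum.distrib sum_distrib_left[symmetric] by (simp add: inner_vec_def)
  finally show "(radial_hessian g e x *v h) $ i
      = (g (norm x) *\<^sub>R h + (e (norm x) / norm x * (x \<bullet> h / norm x)) *\<^sub>R x) $ i"
    by simp
qed

lemma continuous_on_radial_hessian:
  assumes "continuous_on {0<..} g" "continuous_on {0<..} e"
  shows "continuous_on (- {0}) (radial_hessian g e :: real ^ 'n::finite \<Rightarrow> _)"
proof -
  have "continuous_on (- {0}) (\<lambda>x :: real ^ 'n. f (norm x))" if "continuous_on {0<..} f" for f :: "real \<Rightarrow> real"
    by (rule continuous_on_compose2[OF that]) (auto intro!: continuous_intros)
  note * = this[OF assms(1)] this[OF assms(2)]
  have "continuous_on (- {0}) (\<lambda>x :: real ^ 'n. if i = j then g (norm x) else 0)" for i j :: 'n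
    using * by (cases "i = j") auto
  with * show ?thesis
    unfolding radial_hessian_def[abs_def]
    by (intro continuous_on_vec_lambda continuous_on_add continuous_on_mult continuous_on_divide
        continuous_on_norm continuous_on_component continuous_on_id) auto
qed

text \<open>The direction cosines have no limit at the origin, but they are bounded, so their coefficient \<open>e(|x|)\<close> has
to vanish there.\<close>

lemma continuous_on_radial_hessian_UNIV:
  assumes g: "continuous_on {0..} g" and e: "continuous_on {0..} e" and e0: "e 0 = 0"
  shows "continuous_on UNIV (radial_hessian g e :: real ^ 'n::finite \<Rightarrow> _)"
proof -
  have lim: "((\<lambda>x :: real ^ 'n. f (norm x)) \<longlongrightarrow> f 0) (at 0)" if "continuous_on {0..} f" for f :: "real \<Rightarrow> real"
    by (rule filterlim_compose[OF _ filterlim_norm_at_0]) (use that in \<open>auto simp: continuous_on_def\<close>)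
  have off: "continuous_on (- {0}) (radial_hessian g e :: real ^ 'n \<Rightarrow> _)"
    using assms by (intro continuous_on_radial_hessian) (auto intro: continuous_on_subset)
  have "isCont (radial_hessian g e) x" for x :: "real ^ 'n"
  proof (cases "x = 0")
    case False
    then show ?thesis using off continuous_on_eq_continuous_at[of "- {0 :: real ^ 'n}"] by auto
  next
    case True
    have "((\<lambda>x :: real ^ 'n. e (norm x) * (x $ i / norm x) * (x $ j / norm x)) \<longlongrightarrow> 0) (at 0)" for i j
    proof (rule Lim_null_comparison)
      show "((\<lambda>x :: real ^ 'n. \<bar>e (norm x)\<bar>) \<longlongrightarrow> 0) (at 0)"
        using lim[OF e] e0 by (simp add: tendsto_rabs_zero)
      have b: "\<bar>x $ i / norm x\<bar> \<le> 1" for i and x :: "real ^ 'n"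
        using component_le_norm_cart[of x i] by (simp add: divide_le_eq_1)
      have "norm (e (norm x) * (x $ i / norm x) * (x $ j / norm x)) \<le> \<bar>e (norm x)\<bar> * 1 * 1" for x :: "real ^ 'n"
        unfolding real_norm_def abs_mult by (intro mult_mono b) auto
      then show "\<forall>\<^sub>F x :: real ^ 'n in at 0. norm (e (norm x) * (x $ i / norm x) * (x $ j / norm x)) \<le> \<bar>e (norm x)\<bar>"
        by simp
    qed
    moreover have "((\<lambda>x :: real ^ 'n. if i = j then g (norm x) else 0)
        \<longlongrightarrow> (if i = j then g 0 else 0)) (at 0)" for i j :: 'n
      using lim[OF g] by simp
    ultimately have "(radial_hessian g e \<longlongrightarrow> (\<chi> i j. 0 + (if i = j then g 0 else 0))) (at (0 :: real ^ 'n))"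
      unfolding radial_hessian_def[abs_def] by (intro tendsto_vec_lambda tendsto_add) 
    moreover have "radial_hessian g e (0 :: real ^ 'n) = (\<chi> i j. 0 + (if i = j then g 0 else 0))"
      by (simp add: radial_hessian_def vec_eq_iff)
    ultimately show ?thesis using True by (simp add: isCont_def)
  qed
  then show ?thesis by (simp add: continuous_at_imp_continuous_on)
qed

section \<open>From radial solutions to profiles\<close>

text \<open>The one-dimensional map \<open>y \<mapsto> |y|^(p - 2) y\<close>, which is the field of the \<open>p\<close>-Laplacian along a ray.\<close>

definition flux :: "real \<Rightarrow> real \<Rightarrow> real" where
  "flux p y = \<bar>y\<bar> powr (p - 2) * y"

lemma flux_pos: "y > 0 \<Longrightarrow> flux p y = y powr (p - 1)"
  using powr_mult_base[of y "p - 2"] by (simp add: flux_def mult.commute)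

lemma flux_eq_0_iff: "flux p y = 0 \<longleftrightarrow> y = 0"
  by (simp add: flux_def)

lemma flux_nonneg_iff: "flux p y \<ge> 0 \<longleftrightarrow> y \<ge> 0"
  by (auto simp: flux_def zero_le_mult_iff)

text \<open>Both powers have the positive exponent \<open>p - 1\<close>. This gives continuity at \<open>y = 0\<close> also for \<open>p < 2\<close>, where the
factor \<open>|y|^(p - 2)\<close> is singular.\<close>

lemma flux_alt:
  assumes "p > 1"
  shows "flux p y = max y 0 powr (p - 1) - max (- y) 0 powr (p - 1)"
proof -
  consider "y > 0" | "y = 0" | "y < 0" by linarith
  then show ?thesis
  proof cases
    case 3
    then show ?thesis
      using powr_mult_base[of "- y" "p - 2"] by (simp add: flux_def mult.commute)
  qed (auto simp: flux_pos, auto simp: flux_def)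
qed

lemma continuous_on_flux:
  assumes "p > 1" "continuous_on S f"
  shows "continuous_on S (\<lambda>x. flux p (f x))"
  unfolding flux_alt[OF assms(1)] using assms
  by (intro continuous_on_diff continuous_on_powr' continuous_on_max continuous_intros) auto

text \<open>The divergence is only assumed to exist as a sum of partial derivatives. At a point of the \<open>i\<close>-th axis the
\<open>i\<close>-th of them is the derivative of the flux along the ray, so the flux is differentiable. In each of the other \<open>N - 1\<close> directions the component of
the field is \<open>t\<close> times a function continuous at \<open>t = 0\<close> with value \<open>flux / r\<close> there.\<close>

lemma radial_flux_derivative:
  fixes u :: "real ^ 'n::finite \<Rightarrow> real"
  assumes grad: "\<And>x. x \<noteq> 0 \<Longrightarrow> grad u x = (v' (norm x) / norm x) *\<^sub>R x"
    and lap: "has_p_Laplacian p u d (r *\<^sub>R axis i 1)" and r: "r > 0"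
  shows "((\<lambda>s. flux p (v' s)) has_real_derivative
      d - (real CARD('n) - 1) * flux p (v' r) / r) (at r)"
proof -
  let ?e = "\<lambda>j :: 'n. axis j 1 :: real ^ 'n"
  let ?F = "\<lambda>s. flux p (v' s)"
  let ?V = "\<lambda>y. (norm (grad u y) powr (p - 2)) *\<^sub>R grad u y"
  have V: "?V y = (?F (norm y) / norm y) *\<^sub>R y" if "y \<noteq> 0" for y
    using that by (simp add: grad flux_def)
  obtain D where D: "\<And>j. ((\<lambda>t. ?V (r *\<^sub>R ?e i + t *\<^sub>R ?e j) $ j) has_real_derivative D j) (at 0)"
    and d: "d = (\<Sum>j\<in>UNIV. D j)"
    using lap unfolding has_p_Laplacian_def has_divergence_def by blast
  have "((\<lambda>t. ?F (r + t)) has_real_derivative D i) (at 0)"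
  proof (rule DERIV_cong_ev[THEN iffD1, OF refl _ refl D[of i]])
    have "eventually (\<lambda>t. t \<in> {- r<..}) (nhds 0)"
      by (rule eventually_nhds_in_open) (use r in auto)
    then show "eventually (\<lambda>t. ?V (r *\<^sub>R ?e i + t *\<^sub>R ?e i) $ i = ?F (r + t)) (nhds 0)"
    proof eventually_elim
      case (elim t)
      then have "r + t > 0" by simp
      have "r *\<^sub>R ?e i + t *\<^sub>R ?e i = (r + t) *\<^sub>R ?e i" by (simp add: scaleR_left_distrib)
      moreover have "(r + t) *\<^sub>R ?e i \<noteq> 0" using \<open>r + t > 0\<close> by (simp add: axis_eq_0_iff)
      ultimately show ?case using \<open>r + t > 0\<close> V[of "(r + t) *\<^sub>R ?e i"] by simp
    qed
  qed
  then have F: "(?F has_real_derivative D i) (at r)"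
    using DERIV_shift[of ?F "D i" 0 r] by (simp add: add.commute)
  have Dj: "D j = ?F r / r" if "j \<noteq> i" for j
  proof -
    define G where "G t = ?F (sqrt (r\<^sup>2 + t\<^sup>2)) / sqrt (r\<^sup>2 + t\<^sup>2)" for t
    have norm_y: "norm (r *\<^sub>R ?e i + t *\<^sub>R ?e j) = sqrt (r\<^sup>2 + t\<^sup>2)" for t
    proof -
      have "orthogonal (r *\<^sub>R ?e i) (t *\<^sub>R ?e j)"
        using that by (simp add: orthogonal_def inner_axis_axis)
      then have "(norm (r *\<^sub>R ?e i + t *\<^sub>R ?e j))\<^sup>2 = r\<^sup>2 + t\<^sup>2"
        using norm_add_Pythagorean[of "r *\<^sub>R ?e i" "t *\<^sub>R ?e j"] by (simp add: power_mult_distrib)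
      then show ?thesis by (metis norm_ge_zero real_sqrt_unique)
    qed
    have pos: "sqrt (r\<^sup>2 + t\<^sup>2) > 0" for t using r by (simp add: add_pos_nonneg)
    have comp: "?V (r *\<^sub>R ?e i + t *\<^sub>R ?e j) $ j = G t * t" for t
    proof -
      have "r *\<^sub>R ?e i + t *\<^sub>R ?e j \<noteq> 0" using norm_y[of t] pos[of t] by force
      from V[OF this] have "?V (r *\<^sub>R ?e i + t *\<^sub>R ?e j) = G t *\<^sub>R (r *\<^sub>R ?e i + t *\<^sub>R ?e j)"
        unfolding norm_y G_def .
      then show ?thesis using that by (simp add: axis_def)
    qed
    have sqrt0: "((\<lambda>t. sqrt (r\<^sup>2 + t\<^sup>2)) \<longlongrightarrow> r) (at 0)"
      using tendsto_real_sqrt[of "\<lambda>t. r\<^sup>2 + t\<^sup>2" "r\<^sup>2" "at 0"] r by (auto intro!: tendsto_eq_intros)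
    have "((\<lambda>t. G t) \<longlongrightarrow> ?F r / r) (at 0)"
      unfolding G_def using r
      by (intro tendsto_divide sqrt0 isCont_tendsto_compose[OF DERIV_isCont[OF F]]) auto
    then have "((\<lambda>t. G t * t) has_real_derivative ?F r / r) (at 0)"
      unfolding DERIV_def
      by (rule Lim_transform_eventually) (auto simp: eventually_at_filter)
    then show ?thesis using D[of j] unfolding comp by (rule DERIV_unique[rotated])
  qed
  have "d = D i + (\<Sum>j\<in>UNIV - {i}. D j)"
    unfolding d by (rule sum.remove) auto
  also have "(\<Sum>j\<in>UNIV - {i}. D j) = (\<Sum>j\<in>UNIV - {i}. ?F r / r)"
    by (rule sum.cong) (auto simp: Dj)
  also have "\<dots> = (real CARD('n) - 1) * ?F r / r"
    by (simp add: card_Diff_singleton of_nat_diff)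
  finally show ?thesis using F by (simp add: algebra_simps)
qed

text \<open>The flux weighted with \<open>r^(N - 1)\<close> has a nonnegative derivative and is zero at the origin, hence it is
nonnegative and nondecreasing. If it vanished at some \<open>r > 0\<close>, it would vanish on \<open>[0, r]\<close>, and \<open>u\<close> would be
constant on a ball around the origin.\<close>

lemma solution_radial_ode:
  fixes u :: "real ^ 'n::finite \<Rightarrow> real"
  assumes sol: "nonconst_pos_radial_solution m p q u" and p: "p > 1" and N: "CARD('n) \<ge> 2"
  obtains v v' where "\<And>x. u x = v (norm x)" "\<And>r. r \<ge> 0 \<Longrightarrow> v r > 0"
    "\<And>r. (v has_real_derivative v' r) (at r)" "continuous_on UNIV v'" "v' 0 = 0"
    "\<And>r. r > 0 \<Longrightarrow> v' r > 0"
    "\<And>r. r > 0 \<Longrightarrow> ((\<lambda>s. s powr (real CARD('n) - 1) * v' s powr (p - 1)) has_real_derivative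
       r powr (real CARD('n) - 1) * (v r powr m * v' r powr q)) (at r)"
proof -
  define n where "n = real CARD('n) - 1"
  have n: "n > 0" using N by (simp add: n_def)
  have C1: "C1_on UNIV u" and upos: "\<And>x. u x > 0" and rad: "radially_symmetric u"
    and nonconst: "\<And>U. open U \<Longrightarrow> 0 \<in> U \<Longrightarrow> \<not> u constant_on U"
    and lap: "\<And>x. has_p_Laplacian p u (u x powr m * norm (grad u x) powr q) x"
    using sol by (auto simp: nonconst_pos_radial_solution_def solution_regularity_def)
  obtain v v' where uv: "\<And>x. u x = v (norm x)" and der: "\<And>r. (v has_real_derivative v' r) (at r)"
    and cont: "continuous_on UNIV v'" and v'0: "v' 0 = 0"
    and g: "\<And>x. x \<noteq> 0 \<Longrightarrow> grad u x = (v' (norm x) / norm x) *\<^sub>R x"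
    by (rule radial_function_derivative[OF C1 rad]) (rule that; assumption)
  fix i :: 'n
  have vu: "v r = u (r *\<^sub>R axis i 1)" if "r \<ge> 0" for r using that by (simp add: uv)
  have vpos: "v r > 0" if "r \<ge> 0" for r using upos that by (simp add: vu)
  let ?F = "\<lambda>s. flux p (v' s)"
  let ?W = "\<lambda>s. s powr n * ?F s"
  have F: "(?F has_real_derivative v r powr m * \<bar>v' r\<bar> powr q - n * ?F r / r) (at r)" if r: "r > 0" for r
  proof -
    have "r *\<^sub>R (axis i 1 :: real ^ 'n) \<noteq> 0" using r by (simp add: axis_eq_0_iff)
    then have "norm (grad u (r *\<^sub>R axis i 1)) = \<bar>v' r\<bar>" using r by (simp add: g)
    then show ?thesis
      using radial_flux_derivative[where u = u, OF g lap[of "r *\<^sub>R axis i 1"] r] r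
      by (simp add: vu n_def)
  qed
  have W: "(?W has_real_derivative r powr n * (v r powr m * \<bar>v' r\<bar> powr q)) (at r)" if r: "r > 0" for r
  proof -
    have "(?W has_real_derivative n * r powr (n - 1) * ?F r
        + (v r powr m * \<bar>v' r\<bar> powr q - n * ?F r / r) * r powr n) (at r)"
      using r by (intro DERIV_mult F has_real_derivative_powr)
    moreover have "r powr n = r * r powr (n - 1)" using r powr_mult_base[of r "n - 1"] by simp
    then have "n * r powr (n - 1) * ?F r + (v r powr m * \<bar>v' r\<bar> powr q - n * ?F r / r) * r powr n
        = r powr n * (v r powr m * \<bar>v' r\<bar> powr q)"
      using r by (simp add: field_simps)
    ultimately show ?thesis by simp
  qed
  have contW: "continuous_on {0..} ?W"
    using n by (intro continuous_on_mult continuous_on_powr' continuous_on_flux p continuous_intros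
        continuous_on_subset[OF cont]) auto
  have monoW: "?W r \<le> ?W s" if "0 \<le> r" "r \<le> s" for r s
  proof (rule DERIV_nonneg_imp_increasing_open[OF that(2)])
    show "continuous_on {r..s} ?W" by (rule continuous_on_subset[OF contW]) (use that in auto)
    fix x assume x: "r < x" "x < s"
    have "0 \<le> x powr n * (v x powr m * \<bar>v' x\<bar> powr q)" by (intro mult_nonneg_nonneg) auto
    then show "\<exists>y. (?W has_real_derivative y) (at x) \<and> 0 \<le> y" using W[of x] x that by auto
  qed
  have Wnn: "?W r \<ge> 0" if "r \<ge> 0" for r using monoW[OF order_refl that] by simp
  have v'nn: "v' r \<ge> 0" if "r > 0" for r
    using Wnn[of r] that by (simp add: zero_le_mult_iff flux_nonneg_iff)
  have v'pos: "v' r > 0" if r: "r > 0" for r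
  proof (rule ccontr)
    assume "\<not> v' r > 0"
    then have "v' r = 0" using v'nn[OF r] by simp
    then have "?W r = 0" by (simp add: flux_def)
    have zero: "v' s = 0" if "s > 0" "s < r" for s
    proof -
      have "?W s = 0" using monoW[of s r] Wnn[of s] that \<open>?W r = 0\<close> by linarith
      then show ?thesis using that by (simp add: flux_eq_0_iff)
    qed
    have vconst: "v s = v 0" if "s \<ge> 0" "s < r" for s
    proof (cases "s = 0")
      case False
      show ?thesis
      proof (rule DERIV_isconst_end[where f = v])
        show "0 < s" using False that by simp
        show "continuous_on {0..s} v"
          using der by (auto intro!: continuous_at_imp_continuous_on DERIV_isCont)
        show "(v has_real_derivative 0) (at x)" if "0 < x" "x < s" for x
          using der[of x] zero[of x] that \<open>s < r\<close> by simp
      qed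
    qed simp
    have "u constant_on ball 0 r"
      unfolding constant_on_def
      by (intro exI[of _ "v 0"] ballI) (simp add: uv, rule vconst, auto)
    then show False using nonconst[of "ball 0 r"] r by simp
  qed
  have W': "((\<lambda>s. s powr n * v' s powr (p - 1)) has_real_derivative
       r powr n * (v r powr m * v' r powr q)) (at r)" if r: "r > 0" for r
  proof (rule has_field_derivative_transform_within_open[where S = "{0<..}"])
    show "(?W has_real_derivative r powr n * (v r powr m * v' r powr q)) (at r)"
      using W[OF r] v'pos[OF r] by simp
  qed (use r in \<open>auto simp: flux_pos v'pos\<close>)
  show ?thesis
    by (rule that[OF uv vpos der cont v'0 v'pos W'[unfolded n_def]])
qed

text \<open>For \<open>q \<ge> p - 1\<close> the factor \<open>v\<^sup>m v'^(q - (p - 1))\<close> is bounded on \<open>[0, 1]\<close>, so the weighted flux \<open>W\<close> satisfies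
\<open>W' \<le> K W\<close> with \<open>W(0) = 0\<close>. Then \<open>W(r) exp(- K r)\<close> does not increase, which contradicts \<open>W(1) > 0\<close>.\<close>

lemma no_solution_strong_gradient:
  fixes u :: "real ^ 'n::finite \<Rightarrow> real"
  assumes sol: "nonconst_pos_radial_solution m p q u" and p: "p > 1" and N: "CARD('n) \<ge> 2"
    and m: "m > 0" and q: "q \<ge> p - 1"
  shows False
proof -
  define n where "n = real CARD('n) - 1"
  have n: "n > 0" using N by (simp add: n_def)
  obtain v v' where uv: "\<And>x. u x = v (norm x)" and vpos: "\<And>r. r \<ge> 0 \<Longrightarrow> v r > 0"
    and der: "\<And>r. (v has_real_derivative v' r) (at r)" and cont: "continuous_on UNIV v'"
    and v'0: "v' 0 = 0" and v'pos: "\<And>r. r > 0 \<Longrightarrow> v' r > 0"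
    and W: "\<And>r. r > 0 \<Longrightarrow> ((\<lambda>s. s powr n * v' s powr (p - 1)) has_real_derivative
       r powr n * (v r powr m * v' r powr q)) (at r)"
    by (rule solution_radial_ode[OF sol p N, folded n_def]) (rule that; assumption)
  let ?W = "\<lambda>s. s powr n * v' s powr (p - 1)"
  have contv: "continuous_on S v" for S
    using der by (auto intro!: continuous_at_imp_continuous_on DERIV_isCont)
  have v'nn: "v' r \<ge> 0" if "r \<ge> 0" for r using v'pos[of r] v'0 that by (cases "r = 0") auto
  have "compact (v' ` {0..1})"
    by (intro compact_continuous_image continuous_on_subset[OF cont]) auto
  then obtain B where "\<And>y. y \<in> v' ` {0..1} \<Longrightarrow> \<bar>y\<bar> \<le> B"
    using compact_imp_bounded[of "v' ` {0..1}"] by (auto simp: bounded_real)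
  then have B: "v' r \<le> B" if "r \<in> {0..1}" for r using that by (force dest: abs_le_D1)
  have vmono: "v r \<le> v 1" if "0 \<le> r" "r \<le> 1" for r
    by (rule DERIV_nonneg_imp_increasing_open[OF that(2) _ contv])
       (use der v'nn that in \<open>fastforce\<close>)
  define K where "K = v 1 powr m * B powr (q - (p - 1))"
  have le: "r powr n * (v r powr m * v' r powr q) \<le> K * ?W r" if r: "0 < r" "r < 1" for r
  proof -
    have "v' r powr q = v' r powr (q - (p - 1)) * v' r powr (p - 1)"
      by (simp flip: powr_add)
    then have "r powr n * (v r powr m * v' r powr q)
        = (v r powr m * v' r powr (q - (p - 1))) * ?W r" by simp
    also have "\<dots> \<le> K * ?W r"
      unfolding K_def using r q m vpos[of r] v'pos[of r] B[of r] vmono[of r]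
      by (intro mult_right_mono mult_mono powr_mono2) auto
    finally show ?thesis .
  qed
  let ?f = "\<lambda>r. ?W r * exp (- K * r)"
  have "?f 1 \<le> ?f 0"
  proof (rule DERIV_nonpos_imp_decreasing_open[where f = ?f])
    show "continuous_on {0..1} ?f"
      using n p v'nn
      by (intro continuous_on_mult continuous_on_powr' continuous_on_subset[OF cont] continuous_intros) auto
    fix x :: real assume x: "0 < x" "x < 1"
    have "(?f has_real_derivative
        (x powr n * (v x powr m * v' x powr q) - K * ?W x) * exp (- K * x)) (at x)"
    proof -
      have "((\<lambda>r. exp (- K * r)) has_real_derivative - K * exp (- K * x)) (at x)"
        by (auto intro!: derivative_eq_intros)
      note DERIV_mult[OF W[OF x(1)] this]
      moreover have "x powr n * (v x powr m * v' x powr q) * exp (- K * x) + - K * exp (- K * x) * ?W x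
          = (x powr n * (v x powr m * v' x powr q) - K * ?W x) * exp (- K * x)"
        by (simp add: algebra_simps)
      ultimately show ?thesis by (rule DERIV_cong)
    qed
    moreover have "(x powr n * (v x powr m * v' x powr q) - K * ?W x) * exp (- K * x) \<le> 0"
      using le[OF x] by (intro mult_nonpos_nonneg) auto
    ultimately show "\<exists>y. (?f has_real_derivative y) (at x) \<and> y \<le> 0" by blast
  qed simp
  moreover have "?f 1 > 0" using v'pos[of 1] by simp
  ultimately show False by simp
qed

text \<open>With \<open>W = r^(N - 1) v'^(p - 1)\<close> and \<open>c = k / (p - 1)\<close>, the power \<open>W\<^sup>c = r\<^sup>b v'\<^sup>k\<close> has the derivative
\<open>c W^(c - 1) r^(N - 1) v\<^sup>m v'\<^sup>q\<close>. The exponent of \<open>v'\<close> in it is \<open>(p - 1) (c - 1) + q = 0\<close>, and the exponent of \<open>r\<close> is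
\<open>(N - 1) c = b\<close>. Integrating \<open>(r\<^sup>b v'\<^sup>k)' = c r\<^sup>b v\<^sup>m\<close> from the origin gives the integral equation.\<close>

lemma solution_imp_profile:
  fixes u :: "real ^ 'n::finite \<Rightarrow> real"
  assumes sol: "nonconst_pos_radial_solution m p q u" and p: "p > 1" and N: "CARD('n) \<ge> 2"
    and m: "m > 0" and q: "q < p - 1"
  obtains v where "\<And>x. u x = v (norm x)" "v 0 > 0"
    "emden.profile ((p - 1 - q) / (p - 1)) (p - 1 - q) m
       ((real CARD('n) - 1) * (p - 1 - q) / (p - 1)) v"
proof -
  define n where "n = real CARD('n) - 1"
  define k where "k = p - 1 - q"
  define c where "c = k / (p - 1)"
  define b where "b = n * k / (p - 1)"
  have n: "n > 0" and k: "k > 0" using N q by (auto simp: n_def k_def)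
  have c: "c > 0" and b: "b > 0" using p n k by (auto simp: c_def b_def)
  interpret E: emden c k m b by unfold_locales (use c k m b in auto)
  obtain v v' where uv: "\<And>x. u x = v (norm x)" and vpos: "\<And>r. r \<ge> 0 \<Longrightarrow> v r > 0"
    and der: "\<And>r. (v has_real_derivative v' r) (at r)" and cont: "continuous_on UNIV v'"
    and v'0: "v' 0 = 0" and v'pos: "\<And>r. r > 0 \<Longrightarrow> v' r > 0"
    and W: "\<And>r. r > 0 \<Longrightarrow> ((\<lambda>s. s powr n * v' s powr (p - 1)) has_real_derivative
       r powr n * (v r powr m * v' r powr q)) (at r)"
    by (rule solution_radial_ode[OF sol p N, folded n_def]) (rule that; assumption)
  have contv: "continuous_on S v" for S
    using der by (auto intro!: continuous_at_imp_continuous_on DERIV_isCont)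
  have v'nn: "v' r \<ge> 0" if "r \<ge> 0" for r using v'pos[of r] v'0 that by (cases "r = 0") auto
  let ?W = "\<lambda>s. s powr n * v' s powr (p - 1)"
  let ?Z = "\<lambda>s. s powr b * v' s powr k"
  have Z: "(?Z has_real_derivative c * (r powr b * v r powr m)) (at r)" if r: "r > 0" for r
  proof -
    have y: "v' r > 0" using v'pos[OF r] .
    have WZ: "?W s powr c = ?Z s" if "s > 0" for s
      using that v'pos[OF that] p by (simp add: powr_mult powr_powr b_def c_def)
    have "((\<lambda>s. ?W s powr c) has_real_derivative
        c * ?W r powr (c - 1) * (r powr n * (v r powr m * v' r powr q))) (at r)"
      using DERIV_fun_powr[OF W[OF r], of c] r y by simp
    moreover have "?W r powr (c - 1) * (r powr n * (v r powr m * v' r powr q)) = r powr b * v r powr m"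
    proof -
      have "n * (c - 1) + n = b" by (simp add: b_def c_def algebra_simps)
      then have 1: "r powr (n * (c - 1)) * r powr n = r powr b" using r by (simp flip: powr_add)
      have "(p - 1) * (c - 1) + q = 0" using p by (simp add: c_def k_def field_simps)
      then have 2: "v' r powr ((p - 1) * (c - 1)) * v' r powr q = 1" using y by (simp flip: powr_add)
      have "?W r powr (c - 1) = r powr (n * (c - 1)) * v' r powr ((p - 1) * (c - 1))"
        using r y by (simp add: powr_mult powr_powr)
      then have "?W r powr (c - 1) * (r powr n * (v r powr m * v' r powr q))
          = (r powr (n * (c - 1)) * r powr n) * (v' r powr ((p - 1) * (c - 1)) * v' r powr q) * v r powr m"
        by (simp only: mult_ac)
      then show ?thesis unfolding 1 2 by simp
    qed
    ultimately have "((\<lambda>s. ?W s powr c) has_real_derivative c * (r powr b * v r powr m)) (at r)"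
      by (simp add: mult.assoc)
    then show ?thesis
      by (rule has_field_derivative_transform_within_open[where S = "{0<..}"])
         (use r WZ in auto)
  qed
  have contZ: "continuous_on {0..} ?Z"
    using b k v'nn
    by (intro continuous_on_mult continuous_on_powr' continuous_on_subset[OF cont] continuous_intros) auto
  have load: "E.load v r = v' r powr k / r" if r: "r > 0" for r
  proof -
    have "E.load v r = ?Z r / r powr (b + 1)"
      by (rule E.load_eq_primitive[OF contZ _ Z r]) simp
    then show ?thesis using r by (simp add: powr_add)
  qed
  have "E.slope v r = v' r" if "r > 0" for r
    using that v'pos[OF that] k by (simp add: E.slope_def load powr_powr)
  then have "E.profile v"
    using der contv vpos by (auto simp: E.profile_def E.admissible_def less_imp_le)
  then show ?thesis
    using that[of v] uv vpos[of 0] by (simp add: c_def b_def k_def n_def)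
qed

section \<open>From profiles to radial solutions\<close>

text \<open>The gradient of \<open>u(x) = v(|x|)\<close> is \<open>g(|x|) x\<close> with \<open>g(r) = v'(r) / r\<close>, and \<open>v'(r) = (r J(r))^(1/k)\<close> with \<open>J\<close>, the
load of \<open>v\<close>, positive and continuous up to the origin. Thus \<open>g(r) = r^(1/k - 1) J(r)^(1/k)\<close> extends continuously to
\<open>0\<close> exactly when \<open>k \<le> 1\<close>, that is, \<open>p \<le> q + 2\<close>; the limit is \<open>J(0)\<close> for \<open>k = 1\<close> and \<open>0\<close> for \<open>k < 1\<close>. Moreover
\<open>r g'(r)\<close> is \<open>g(r)\<close> times a function with limit \<open>1 / k - 1\<close>, so it tends to \<open>0\<close> in both cases, which is
what continuity of the Hessian requires. The field of the \<open>p\<close>-Laplacian is \<open>P(|x|) x\<close> with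
\<open>P(r) = v'(r)^(p - 1) / r\<close>. Away from the origin its divergence follows from the differential equation for \<open>J\<close>;
at the origin \<open>P\<close> tends to \<open>0\<close>, which agrees with the vanishing right-hand side of the equation there.\<close>

lemma profile_imp_solution:
  assumes p: "p > 1" and m: "m > 0" and q: "q > 0" "q < p - 1" and N: "CARD('n::finite) \<ge> 2"
    and v: "emden.profile ((p - 1 - q) / (p - 1)) (p - 1 - q) m
       ((real CARD('n) - 1) * (p - 1 - q) / (p - 1)) v"
    and pos: "v 0 > 0"
  shows "nonconst_pos_radial_solution m p q (\<lambda>x :: real ^ 'n. v (norm x))"
proof -
  define n where "n = real CARD('n) - 1"
  define k where "k = p - 1 - q"
  define c where "c = k / (p - 1)"
  define b where "b = n * k / (p - 1)"
  have n: "n > 0" and k: "k > 0" using N q by (auto simp: n_def k_def)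
  have c: "c > 0" and b: "b > 0" using p n k by (auto simp: c_def b_def)
  interpret E: emden c k m b by unfold_locales (use c k m b in auto)
  have v: "E.profile v" using v by (simp add: c_def b_def k_def n_def)
  let ?u = "\<lambda>x :: real ^ 'n. v (norm x)"
  let ?s = "E.slope v" and ?J = "E.load v"
  have J: "?J r > 0" if "r \<ge> 0" for r using E.load_pos[OF v pos that] .
  have J_ne: "?J r \<noteq> 0" if "r \<ge> 0" for r using J[OF that] by simp
  have s_pos: "?s r > 0" if "r > 0" for r using E.slope_pos[OF v pos that] .
  have s0: "?s 0 = 0" by (simp add: E.slope_def)
  have contJ: "continuous_on {0..} ?J" by (rule E.continuous_on_load[OF E.profileD(1)[OF v]])
  have conts: "continuous_on {0..} ?s" by (rule E.continuous_on_slope[OF E.profileD(1)[OF v]])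
  have contv: "continuous_on {0..} v" by (rule E.profileD(2)[OF v])
  have vpos: "v r > 0" if "r \<ge> 0" for r using E.profile_mono[OF v order_refl that] pos by simp
  have v_ne: "v r \<noteq> 0" if "r \<ge> 0" for r using vpos[OF that] by simp

  define g0 where "g0 = (if k = 1 then ?J 0 else 0)"
  define g where "g r = (if r = 0 then g0 else ?s r / r)" for r
  \<comment> \<open>This is \<open>r g'(r)\<close>, written without powers of \<open>r\<close> so that it also makes sense at \<open>0\<close>.\<close>
  define e where "e r = g r * ((c * v r powr m / ?J r - b) / k - 1)" for r
  have contg: "continuous_on {0<..} g"
  proof -
    have "continuous_on {0<..} (\<lambda>r. ?s r / r)"
      by (intro continuous_on_divide continuous_on_subset[OF conts] continuous_intros) auto
    then show ?thesis by (rule continuous_on_eq) (auto simp: g_def)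
  qed
  have contf: "continuous_on {0..} (\<lambda>r. (c * v r powr m / ?J r - b) / k - 1)"
    using k J m vpos
    by (intro continuous_intros continuous_on_powr' contJ contv) (auto simp: less_imp_le J_ne v_ne)
  have conte: "continuous_on {0<..} e"
    unfolding e_def[abs_def] by (intro continuous_on_mult contg continuous_on_subset[OF contf]) auto
  have contg0: "continuous_on {0..} g" if "k \<le> 1"
  proof (cases "k = 1")
    case True
    have "g r = ?J r" if "r \<ge> 0" for r
      unfolding g_def g0_def E.slope_def using that True J[OF that] by auto
    then show ?thesis using contJ by (subst continuous_on_cong[OF refl]) auto
  next
    case False
    then have k1: "1 / k - 1 > 0" using that k by simp
    have "g r = r powr (1 / k - 1) * ?J r powr (1 / k)" if "r \<ge> 0" for r
      using that k1 J[OF that] False by (simp add: g_def g0_def E.slope_def powr_mult powr_diff)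
    moreover have "continuous_on {0..} (\<lambda>r. r powr (1 / k - 1) * ?J r powr (1 / k))"
      using k1 J k by (intro continuous_on_mult continuous_on_powr' contJ continuous_intros) (auto simp: less_imp_le)
    ultimately show ?thesis by (subst continuous_on_cong[OF refl]) auto
  qed
  have conte0: "continuous_on {0..} e" if "k \<le> 1"
    unfolding e_def[abs_def] by (intro continuous_on_mult contg0[OF that] contf)
  have e0: "e 0 = 0"
  proof (cases "k = 1")
    case True
    have "?J 0 = c * v 0 powr m / (b + 1)" using E.load_0 pos by simp
    \<comment> \<open>For \<open>k = 1\<close> the factor of \<open>g\<close> is \<open>c v(0)\<^sup>m / J(0) - b - 1\<close>, which is zero.\<close>
    moreover have "b + 1 \<noteq> 0" "c * v 0 powr m \<noteq> 0" using b c pos by auto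
    ultimately have "c * v 0 powr m / ?J 0 = b + 1" by simp
    then show ?thesis using True by (simp add: e_def)
  qed (simp add: e_def g_def g0_def)
  have g_der: "(g has_real_derivative e r / r) (at r)" if r: "r > 0" for r
  proof -
    have "((\<lambda>r. ?s r / r) has_real_derivative
        (?s r / (k * r) * (c * v r powr m / ?J r - b) * r - ?s r * 1) / (r * r)) (at r)"
      using r by (intro DERIV_divide E.slope_has_derivative[OF v pos r] DERIV_ident) auto
    moreover have "(?s r / (k * r) * X * r - ?s r * 1) / (r * r) = g r * (X / k - 1) / r" for X
      using r k by (simp add: g_def field_simps)
    ultimately have "((\<lambda>r. ?s r / r) has_real_derivative e r / r) (at r)"
      unfolding e_def by (simp only:)
    then show ?thesis
      by (rule has_field_derivative_transform_within_open[where S = "{0<..}"])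
         (use r in \<open>auto simp: g_def\<close>)
  qed

  have grad: "grad ?u x = g (norm x) *\<^sub>R x" for x
  proof (cases "x = 0")
    case True
    have "grad ?u 0 = 0"
      unfolding grad_eqI[OF radial_has_derivative_0[OF E.profile_derivative_0[OF v]]]
      by (simp add: vec_eq_iff)
    then show ?thesis using True by simp
  next
    case False
    then show ?thesis
      using grad_radial[OF E.profileD(4)[OF v], of x] by (simp add: g_def)
  qed
  then have grad': "grad ?u = (\<lambda>x. g (norm x) *\<^sub>R x)" by blast
  have norm_grad: "norm (grad ?u x) = ?s (norm x)" for x
    using s_pos[of "norm x"] s0 by (cases "x = 0") (auto simp: grad g_def E.slope_nonneg)

  have "?u differentiable (at x)" for x
    using radial_has_derivative_0[OF E.profile_derivative_0[OF v]]
      radial_has_derivative[OF E.profileD(4)[OF v], of x]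
    by (cases "x = 0") (auto simp: differentiable_def)
  moreover have "continuous_on UNIV (grad ?u)"
  proof -
    have "isCont (grad ?u) x" for x
    proof (cases "x = 0")
      case True
      have "(?s \<longlongrightarrow> ?s 0) (at 0 within {0..})" using conts by (auto simp: continuous_on_def)
      then have "((\<lambda>x :: real ^ 'n. ?s (norm x)) \<longlongrightarrow> 0) (at 0)"
        unfolding s0 using filterlim_norm_at_0 by (rule filterlim_compose)
      then have "(grad ?u \<longlongrightarrow> 0) (at 0)"
        by (intro tendsto_norm_zero_cancel[of "grad ?u"]) (simp add: norm_grad)
      then show ?thesis using True by (simp add: isCont_def grad)
    next
      case False
      then have "((\<lambda>x. g (norm x) *\<^sub>R x) has_derivative
          (\<lambda>h. g (norm x) *\<^sub>R h + (e (norm x) / norm x * (x \<bullet> h / norm x)) *\<^sub>R x)) (at x)"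
        by (intro radial_field_has_derivative g_der) auto
      then show ?thesis unfolding grad' by (rule has_derivative_continuous)
    qed
    then show ?thesis by (simp add: continuous_at_imp_continuous_on)
  qed
  ultimately have C1: "C1_on S ?u" for S
    unfolding C1_on_def by (auto intro: continuous_on_subset)

  have H_off: "(grad ?u has_derivative (\<lambda>h. radial_hessian g e x *v h)) (at x)" if "x \<noteq> 0" for x
    unfolding grad' radial_hessian_mult using that by (intro radial_field_has_derivative g_der) auto
  have H_0: "(grad ?u has_derivative (\<lambda>h. radial_hessian g e x *v h)) (at x)" if "k \<le> 1" "x = 0" for x
  proof -
    have "(g \<longlongrightarrow> g 0) (at 0 within {0..})"
      using contg0[OF that(1)] by (auto simp: continuous_on_def)
    from radial_field_has_derivative_0[OF this] show ?thesis
      unfolding grad' radial_hessian_mult using that(2) by simp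
  qed
  have "C2_on (if p \<le> q + 2 then UNIV else - {0}) ?u"
  proof (cases "p \<le> q + 2")
    case True
    then have "k \<le> 1" by (simp add: k_def)
    then have "\<forall>x\<in>UNIV. (grad ?u has_derivative (\<lambda>h. radial_hessian g e x *v h)) (at x)"
      using H_off H_0 by blast
    moreover have "continuous_on UNIV (radial_hessian g e :: real ^ 'n \<Rightarrow> _)"
      using contg0 conte0 e0 \<open>k \<le> 1\<close> by (intro continuous_on_radial_hessian_UNIV)
    ultimately show ?thesis using C1 True unfolding C2_on_def by auto
  next
    case False
    then show ?thesis
      using C1 H_off continuous_on_radial_hessian[OF contg conte] unfolding C2_on_def by auto
  qed
  then have reg: "solution_regularity p q ?u"
    using C1 unfolding solution_regularity_def by blast

  have nonconst: "\<not> ?u constant_on U" if U: "open U" "0 \<in> U" for U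
  proof
    assume "?u constant_on U"
    obtain d where d: "d > 0" "ball 0 d \<subseteq> U" by (rule openE[OF U])
    fix i :: 'n
    have "(d / 2) *\<^sub>R axis i 1 \<in> ball (0 :: real ^ 'n) d" using d(1) by (simp add: dist_norm)
    then have "(d / 2) *\<^sub>R axis i 1 \<in> U" using d(2) by blast
    with \<open>?u constant_on U\<close> U(2)
    have "v (norm ((d / 2) *\<^sub>R axis i 1 :: real ^ 'n)) = v (norm (0 :: real ^ 'n))"
      unfolding constant_on_def by metis
    then have "v (d / 2) = v 0" using d by simp
    moreover have "v 0 < v (d / 2)"
    proof (rule DERIV_pos_imp_increasing_open[where f = v])
      show "continuous_on {0..d / 2} v" by (rule continuous_on_subset[OF contv]) auto
      show "\<exists>y. (v has_real_derivative y) (at x) \<and> 0 < y" if "0 < x" "x < d / 2" for x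
        using E.profileD(4)[OF v that(1)] s_pos[OF that(1)] by blast
    qed (use d in auto)
    ultimately show False by simp
  qed

  define P where "P r = ?s r powr (p - 1) / r" for r
  have field: "(\<lambda>y. (norm (grad ?u y) powr (p - 2)) *\<^sub>R grad ?u y) = (\<lambda>y. P (norm y) *\<^sub>R y)"
  proof
    fix y
    show "(norm (grad ?u y) powr (p - 2)) *\<^sub>R grad ?u y = P (norm y) *\<^sub>R y"
    proof (cases "y = 0")
      case False
      then have "?s (norm y) > 0" using s_pos by simp
      then have "?s (norm y) powr (p - 2) * ?s (norm y) = ?s (norm y) powr (p - 1)"
        using powr_mult_base[of "?s (norm y)" "p - 2"] by (simp add: mult.commute)
      then show ?thesis unfolding norm_grad unfolding grad using False by (simp add: g_def P_def)
    qed (simp add: grad)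
  qed
  have exps: "(p - 1) / k = q / k + 1" "(p - 1) / k * c = 1" "(p - 1) / k * b = n"
  proof -
    have "p - 1 = q + k" by (simp add: k_def)
    then show "(p - 1) / k = q / k + 1" using k by (simp add: add_divide_distrib)
  qed (use k p in \<open>simp_all add: c_def b_def\<close>)
  have flux: "?s r powr (p - 1) = ?s r powr q * (r * ?J r)" if "r > 0" for r
  proof -
    have "r * ?J r > 0" using that J[of r] by simp
    then show ?thesis
      unfolding E.slope_def powr_powr by (simp add: exps(1) powr_add)
  qed
  have lap: "has_p_Laplacian p ?u (?u x powr m * norm (grad ?u x) powr q) x" for x
  proof (cases "x = 0")
    case False
    define r where "r = norm x"
    have r: "r > 0" using False by (simp add: r_def)
    let ?S = "?s r powr (p - 1)"
    let ?D = "(p - 1) / k * ?S / r * (c * v r powr m / ?J r - b)"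
    have "(P has_real_derivative (?D * r - ?S * 1) / (r * r)) (at r)"
      unfolding P_def using r by (intro DERIV_divide E.slope_power_has_derivative[OF v pos r] DERIV_ident) auto
    then have "has_divergence (\<lambda>x :: real ^ 'n. P (norm x) *\<^sub>R x)
        (norm x * ((?D * r - ?S * 1) / (r * r)) + real CARD('n) * P (norm x)) x"
      using False unfolding r_def by (intro has_divergence_radial_field)
    moreover have "norm x * ((?D * r - ?S * 1) / (r * r)) + real CARD('n) * P (norm x)
        = ?u x powr m * norm (grad ?u x) powr q"
    proof -
      have Jr: "?J r > 0" using J[of r] r by simp
      have "A * S / r * (c * V / L - b) = S / r * (A * c * V / L - A * b)" for A S V L :: real
        by (simp add: right_diff_distrib mult_ac)
      then have "?D = ?S / r * (((p - 1) / k * c) * v r powr m / ?J r - (p - 1) / k * b)" .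
      also have "\<dots> = ?S / r * (v r powr m / ?J r - n)" unfolding exps(2,3) by simp
      finally have D: "?D = ?S / r * (v r powr m / ?J r - n)" .
      have "r * ((?S / r * (v r powr m / ?J r - n) * r - ?S * 1) / (r * r)) + (n + 1) * (?S / r)
          = ?S / (r * ?J r) * v r powr m"
        using r Jr by (simp add: field_simps)
      also have "\<dots> = v r powr m * ?s r powr q"
        using r Jr unfolding flux[OF r] by simp
      finally show ?thesis
        unfolding D norm_grad r_def[symmetric] P_def by (simp add: n_def)
    qed
    ultimately show ?thesis unfolding has_p_Laplacian_def field by simp
  next
    case True
    have "((\<lambda>r. (r * ?J r) powr (q / k) * ?J r) \<longlongrightarrow> (0 * ?J 0) powr (q / k) * ?J 0) (at 0 within {0..})"
    proof -
      have "continuous_on {0..} (\<lambda>r. (r * ?J r) powr (q / k) * ?J r)"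
        using q k J by (intro continuous_on_mult continuous_on_powr' contJ continuous_intros)
          (auto simp: less_imp_le)
      then show ?thesis unfolding continuous_on_def by (elim ballE[where x = 0]) auto
    qed
    moreover have "eventually (\<lambda>r. (r * ?J r) powr (q / k) * ?J r = P r) (at 0 within {0..})"
    proof -
      have "(r * ?J r) powr (q / k) * ?J r = P r" if "r > 0" for r
        using that unfolding P_def flux[OF that] by (simp add: E.slope_def powr_powr)
      then show ?thesis by (auto simp: eventually_at_filter)
    qed
    ultimately have "(P \<longlongrightarrow> 0) (at 0 within {0..})"
      using Lim_transform_eventually by force
    from radial_field_has_derivative_0[OF this, where 'a = "real ^ 'n"]
    have "has_divergence (\<lambda>x :: real ^ 'n. P (norm x) *\<^sub>R x) 0 0"
      by (rule has_divergence_of_derivative) simp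
    moreover have "?u x powr m * norm (grad ?u x) powr q = 0" using True by (simp add: norm_grad s0)
    ultimately show ?thesis unfolding has_p_Laplacian_def field using True by (simp only:)
  qed
  show ?thesis
    unfolding nonconst_pos_radial_solution_def radially_symmetric_def
    using reg vpos nonconst lap by auto
qed

section \<open>Classification of radial solutions\<close>

theorem corollary1p5:
  fixes m p q :: real
  assumes "CARD('n::finite) \<ge> 2" and "m > 0" and "q > 0" and "p > 1" and "m + q \<noteq> p - 1"
  shows "((\<exists>u :: real ^ 'n \<Rightarrow> real. nonconst_pos_radial_solution m p q u)
            \<longleftrightarrow> 0 < q \<and> q < p - 1 \<and> m < p - q - 1) \<and>
         (0 < q \<and> q < p - 1 \<and> m < p - q - 1 \<longrightarrow>
            (\<exists>C>0. \<forall>u :: real ^ 'n \<Rightarrow> real. nonconst_pos_radial_solution m p q u \<longrightarrow>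
               ((\<lambda>x. u x / norm x powr ((p - q) / (p - 1 - m - q))) \<longlongrightarrow> C) at_infinity)) \<and>
         (0 < q \<and> q < p - 1 \<and> m < p - q - 1 \<and> 1 < p \<and> p < real CARD('n) \<longrightarrow>
            (\<forall>a>0. \<exists>!u :: real ^ 'n \<Rightarrow> real. nonconst_pos_radial_solution m p q u \<and> u 0 = a))"
proof -
  define k where "k = p - 1 - q"
  define c where "c = k / (p - 1)"
  define b where "b = (real CARD('n) - 1) * k / (p - 1)"
  have emden: "emden c k m b" if "q < p - 1"
    using that assms by unfold_locales (auto simp: c_def k_def b_def)
  note defs = c_def b_def k_def
  have to_profile: "\<exists>v. (\<forall>x. u x = v (norm x)) \<and> v 0 > 0 \<and> emden.profile c k m b v"
    if "nonconst_pos_radial_solution m p q u" "q < p - 1" for u :: "real ^ 'n \<Rightarrow> real"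
    using solution_imp_profile[OF that(1) assms(4,1,2) that(2)] unfolding defs by metis
  have from_profile: "nonconst_pos_radial_solution m p q (\<lambda>x :: real ^ 'n. v (norm x))"
    if "emden.profile c k m b v" "v 0 > 0" "q < p - 1" for v
    using profile_imp_solution[where 'n = 'n and v = v, OF assms(4,2,3) that(3) assms(1) _ that(2)] that(1)
    unfolding defs by simp
  have necessary: "q < p - 1 \<and> m < k" if sol: "nonconst_pos_radial_solution m p q u" for u :: "real ^ 'n \<Rightarrow> real"
  proof -
    have q: "q < p - 1"
      using no_solution_strong_gradient[OF sol assms(4,1,2)] by force
    obtain v where "v 0 > 0" "emden.profile c k m b v" using to_profile[OF sol q] by blast
    then have "\<not> k < m" using emden.no_profile[OF emden[OF q]] by blast
    then show ?thesis using q assms(5) by (simp add: k_def)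
  qed
  have solution: "\<exists>u :: real ^ 'n \<Rightarrow> real. nonconst_pos_radial_solution m p q u \<and> u 0 = a"
    if q: "q < p - 1" and sub: "m < k" and a: "a > 0" for a
  proof -
    obtain v where "emden.profile c k m b v" "v 0 = a"
      using emden.profile_exists[OF emden[OF q] a sub] by blast
    then show ?thesis
      using from_profile[of v] q a by (intro exI[of _ "\<lambda>x. v (norm x)"]) auto
  qed
  have unique: "u = w"
    if u: "nonconst_pos_radial_solution m p q u" and w: "nonconst_pos_radial_solution m p q w"
      and "u 0 = w 0" and q: "q < p - 1" and sub: "m < k" for u w :: "real ^ 'n \<Rightarrow> real"
  proof -
    obtain v1 where v1: "\<And>x. u x = v1 (norm x)" "v1 0 > 0" "emden.profile c k m b v1"
      using to_profile[OF u q] by blast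
    obtain v2 where v2: "\<And>x. w x = v2 (norm x)" "v2 0 > 0" "emden.profile c k m b v2"
      using to_profile[OF w q] by blast
    have "v1 0 = v2 0" using \<open>u 0 = w 0\<close> v1(1) v2(1) by simp
    then have "v1 r = v2 r" if "r \<ge> 0" for r
      using emden.profile_unique[OF emden[OF q] v1(3) v2(3) _ v1(2) sub that] by simp
    then show ?thesis using v1(1) v2(1) by auto
  qed
  have limit: "\<exists>C>0. \<forall>u :: real ^ 'n \<Rightarrow> real. nonconst_pos_radial_solution m p q u \<longrightarrow>
      ((\<lambda>x. u x / norm x powr ((p - q) / (p - 1 - m - q))) \<longlongrightarrow> C) at_infinity"
    if q: "q < p - 1" and sub: "m < k"
  proof (intro exI conjI allI impI)
    interpret E: emden c k m b by (rule emden[OF q])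
    show "E.amplitude > 0" by (rule E.amplitude_pos[OF sub])
    fix u :: "real ^ 'n \<Rightarrow> real" assume "nonconst_pos_radial_solution m p q u"
    then obtain v where v: "\<And>x. u x = v (norm x)" "v 0 > 0" "E.profile v"
      using to_profile[OF _ q] by blast
    have "((\<lambda>x :: real ^ 'n. v (norm x) / norm x powr E.rate) \<longlongrightarrow> E.amplitude) at_infinity"
      by (rule filterlim_compose[OF E.profile_asymptotics[OF v(3,2) sub] filterlim_norm_at_top])
    moreover have "E.rate = (p - q) / (p - 1 - m - q)" unfolding E.rate_def by (simp add: k_def algebra_simps)
    ultimately show "((\<lambda>x. u x / norm x powr ((p - q) / (p - 1 - m - q))) \<longlongrightarrow> E.amplitude) at_infinity"
      by (simp add: v(1))
  qed
  have k_iff: "m < p - q - 1 \<longleftrightarrow> m < k" by (auto simp: k_def)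
  have "(\<exists>u :: real ^ 'n \<Rightarrow> real. nonconst_pos_radial_solution m p q u) \<longleftrightarrow> q < p - 1 \<and> m < k"
    using necessary solution[of 1] by auto
  moreover have "\<exists>!u :: real ^ 'n \<Rightarrow> real. nonconst_pos_radial_solution m p q u \<and> u 0 = a"
    if "q < p - 1" "m < k" "a > 0" for a
    using solution[OF that] unique that by (metis (no_types, lifting))
  ultimately show ?thesis
    using limit assms(3) unfolding k_iff by auto
qed

end
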